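(* Let $X$ be a connected manifold with $H_1(X,\mathbb{Z})=0$ and let $F:X\to\mathbb{R}^2$ be a local diffeomorphism. Assume that the restriction $F:X-F^{-1}(D)\to\mathbb{R}^2-D$ is a $d$-sheeted cover for a finite subset $D\subset\mathbb{R}^2$. Then $d=1$ or $d=\infty$.
   Context: Manifolds and local diffeomorphisms are smooth. The sheet number $d$ is a positive integer or $\infty$. *)

theory Defs
  imports
    "HOL-Analysis.Analysis"
    "HOL-Homology.Homology"
    "HOL-Library.Extended_Nat"
begin

text \<open>
  Smoothness on an open subset of a Euclidean space: all iterated directional derivatives exist
  and are continuous. The definitions are only meant for open \<open>S\<close>, since the derivatives are
  taken at points of the full space.
\<close>

primrec higher_differentiable_on ::
    "'e::euclidean_space set \<Rightarrow> ('e \<Rightarrow> 'f::euclidean_space) \<Rightarrow> nat \<Rightarrow> bool" where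
  "higher_differentiable_on S f 0 \<longleftrightarrow> continuous_on S f"
| "higher_differentiable_on S f (Suc n) \<longleftrightarrow>
     (\<forall>x\<in>S. f differentiable (at x)) \<and>
     (\<forall>v. higher_differentiable_on S (\<lambda>x. frechet_derivative f (at x) v) n)"

definition smooth_on :: "'e::euclidean_space set \<Rightarrow> ('e \<Rightarrow> 'f::euclidean_space) \<Rightarrow> bool" where
  "smooth_on S f \<longleftrightarrow> (\<forall>n. higher_differentiable_on S f n)"

text \<open>
  A manifold is a set \<open>M\<close> with the subspace topology, together with a smooth atlas (not necessarily
  maximal). A chart is a pair of its domain and its coordinate map, which is relevant only on the
  domain.
\<close>

type_synonym ('a, 'e) chart = "'a set \<times> ('a \<Rightarrow> 'e)"

definition chart_on :: "'a::topological_space set \<Rightarrow> ('a, 'e::euclidean_space) chart \<Rightarrow> bool" where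
  "chart_on M = (\<lambda>(U, \<phi>). openin (top_of_set M) U \<and> open (\<phi> ` U) \<and>
     homeomorphism U (\<phi> ` U) \<phi> (inv_into U \<phi>))"

definition smooth_manifold ::
    "'a::topological_space set \<Rightarrow> ('a, 'e::euclidean_space) chart set \<Rightarrow> bool" where
  "smooth_manifold M \<A> \<longleftrightarrow>
     Hausdorff_space (top_of_set M) \<and>
     second_countable (top_of_set M) \<and>
     (\<forall>c\<in>\<A>. chart_on M c) \<and>
     (\<Union>(U, \<phi>)\<in>\<A>. U) = M \<and>
     (\<forall>(U, \<phi>)\<in>\<A>. \<forall>(V, \<psi>)\<in>\<A>. smooth_on (\<phi> ` (U \<inter> V)) (\<psi> \<circ> inv_into U \<phi>))"

text \<open>
  Smoothness of a map from \<open>M\<close> to \<open>N\<close>, where \<open>M\<close> and \<open>N\<close> are open subsets of manifolds with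
  atlases \<open>\<A>\<close> and \<open>\<B>\<close>. Continuity makes the sets on which the local representatives are tested open.
\<close>

definition smooth_map ::
    "'a::topological_space set \<Rightarrow> ('a, 'e::euclidean_space) chart set \<Rightarrow>
     'b::topological_space set \<Rightarrow> ('b, 'f::euclidean_space) chart set \<Rightarrow> ('a \<Rightarrow> 'b) \<Rightarrow> bool" where
  "smooth_map M \<A> N \<B> f \<longleftrightarrow>
     continuous_on M f \<and> f \<in> M \<rightarrow> N \<and>
     (\<forall>(U, \<phi>)\<in>\<A>. \<forall>(V, \<psi>)\<in>\<B>.
        smooth_on (\<phi> ` (M \<inter> U \<inter> f -` V)) (\<psi> \<circ> f \<circ> inv_into U \<phi>))"

definition local_diffeomorphism ::
    "'a::topological_space set \<Rightarrow> ('a, 'e::euclidean_space) chart set \<Rightarrow>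
     'b::topological_space set \<Rightarrow> ('b, 'f::euclidean_space) chart set \<Rightarrow> ('a \<Rightarrow> 'b) \<Rightarrow> bool" where
  "local_diffeomorphism M \<A> N \<B> f \<longleftrightarrow>
     (\<forall>x\<in>M. \<exists>U V g. x \<in> U \<and> openin (top_of_set M) U \<and> openin (top_of_set N) V \<and>
        homeomorphism U V f g \<and> smooth_map U \<A> V \<B> f \<and> smooth_map V \<B> U \<A> g)"

definition euclidean_atlas :: "('e, 'e::euclidean_space) chart set" where
  "euclidean_atlas = {(UNIV, id)}"

text \<open>
  The sheet number is the cardinality of every fibre, all infinite cardinalities being identified
  with \<open>\<infinity>\<close>.
\<close>

definition has_ecard :: "'a set \<Rightarrow> enat \<Rightarrow> bool" where
  "has_ecard A d \<longleftrightarrow> (case d of enat n \<Rightarrow> finite A \<and> card A = n | \<infinity> \<Rightarrow> infinite A)"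

definition sheeted_covering ::
    "enat \<Rightarrow> 'a::topological_space set \<Rightarrow> ('a \<Rightarrow> 'b) \<Rightarrow> 'b::topological_space set \<Rightarrow> bool" where
  "sheeted_covering d C p S \<longleftrightarrow>
     covering_space C p S \<and> (\<forall>y\<in>S. has_ecard {x \<in> C. p x = y} d)"

end

theory Submission
  imports Defs
begin

text \<open>
  Let \<open>d = n\<close> be finite. The argument is topological: \<open>X\<close> is a Hausdorff space and \<open>F\<close> a local
  homeomorphism. The heart of the proof is that every
  fibre over a point \<open>p\<close> of \<open>D\<close> also has exactly \<open>n\<close> points (\<open>puncture_fibre_card\<close>). Once this is
  known, \<open>F\<close> is a covering of the whole plane (\<open>covering_space_of_constant_fibre_card\<close>). The identity
  of the plane lifts to a section of \<open>F\<close>; since \<open>X\<close> is connected, the section is an inverse, so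
  \<open>F\<close> is injective and \<open>n = 1\<close>.

  To count the fibre over \<open>p\<close>, translate and rotate so that \<open>p = 0\<close> and the positive real axis
  misses \<open>D\<close>. Distinct points over \<open>0\<close> have disjoint neighbourhoods that map homeomorphically to a small
  disc, so there are at most \<open>n\<close> of them. If there are fewer, then some point over the punctured
  disc lies in none of these neighbourhoods, and the sheet through it winds around a puncture that no
  point of \<open>X\<close> fills. The map \<open>exp\<close> sends the union \<open>\<Omega>\<close> of a left half-plane and a thin
  horizontal strip to the union of a punctured disc and a sector around the positive real axis, which
  misses \<open>D\<close>. As \<open>\<Omega>\<close> is starlike, \<open>exp\<close> lifts to a map \<open>l\<close> from \<open>\<Omega>\<close> to \<open>X\<close> through the chosen
  point, and the image of \<open>l\<close> stays away from all points over \<open>0\<close>.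

  This contradicts \<open>H\<^sub>1(X) = 0\<close> (\<open>unfilled_puncture_contradiction\<close>). The image under \<open>l\<close> of
  a closed substrip is a closed subset of \<open>X\<close>: it runs to infinity at one end and into the unfilled
  puncture at the other. Sending it once around the circle according to the argument, and everything
  else to \<open>1\<close>, gives a continuous map \<open>\<theta>\<close> from \<open>X\<close> to the circle (\<open>circle_map_of_closed_sector\<close>). On
  the other hand fibres are finite, so \<open>l\<close> has a least period \<open>2\<pi>im\<close> on the half-plane, and the
  image of one period is a loop that crosses the strip exactly once. Hence \<open>\<theta>\<close> maps this loop to a
  generator of the fundamental group of the circle, which is impossible when \<open>H\<^sub>1(X) = 0\<close>
  (\<open>loop_not_mapped_to_circle_generator\<close>). For infinite \<open>d\<close> there need not be
  such a loop, because \<open>l\<close> may fail to have a period.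
\<close>

section \<open>Lifting through covering spaces\<close>

lemma evenly_covered:
  assumes "covering_space C p S" "y \<in> S"
  obtains N v where "y \<in> N" "openin (top_of_set S) N" "\<Union>v = C \<inter> p -` N"
    "\<And>u. u \<in> v \<Longrightarrow> openin (top_of_set C) u" "pairwise disjnt v"
    "\<And>u. u \<in> v \<Longrightarrow> \<exists>q. homeomorphism u N p q"
  using assms unfolding covering_space_def by metis

text \<open>
  Near any point the two lifts lie in sheets; if the sheets coincide the lifts agree nearby, and
  otherwise they differ nearby. So the set of agreement is open and closed. Working with sheets
  instead of with differences of values allows an arbitrary topological space as total space.
\<close>

lemma covering_lifts_agree:
  fixes p :: "'a::topological_space \<Rightarrow> 'b::topological_space"
    and g1 g2 :: "'c::topological_space \<Rightarrow> 'a"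
  assumes cov: "covering_space C p S"
    and g1: "continuous_on T g1" "g1 ` T \<subseteq> C"
    and g2: "continuous_on T g2" "g2 ` T \<subseteq> C"
    and lifts: "\<And>x. x \<in> T \<Longrightarrow> p (g1 x) = p (g2 x)"
    and "connected T" "a \<in> T" "g1 a = g2 a" "x \<in> T"
  shows "g1 x = g2 x"
proof -
  have sheets: "\<exists>W. openin (top_of_set T) W \<and> y \<in> W \<and>
      ((\<forall>w\<in>W. g1 w = g2 w) \<or> (\<forall>w\<in>W. g1 w \<noteq> g2 w))" if y: "y \<in> T" for y
  proof -
    have "p (g1 y) \<in> S"
      using y g1(2) covering_space_imp_surjective[OF cov] by blast
    then obtain N v where N: "p (g1 y) \<in> N" "\<Union>v = C \<inter> p -` N"
        "\<And>u. u \<in> v \<Longrightarrow> openin (top_of_set C) u" "pairwise disjnt v"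
        "\<And>u. u \<in> v \<Longrightarrow> \<exists>q. homeomorphism u N p q"
      using evenly_covered[OF cov] by metis
    have "g1 y \<in> \<Union>v" "g2 y \<in> \<Union>v"
      using N(1,2) y g1(2) g2(2) lifts[OF y] by auto
    then obtain u1 u2 where u: "u1 \<in> v" "g1 y \<in> u1" "u2 \<in> v" "g2 y \<in> u2" by blast
    define W where "W = (T \<inter> g1 -` u1) \<inter> (T \<inter> g2 -` u2)"
    have "openin (top_of_set T) (T \<inter> g1 -` u1)" "openin (top_of_set T) (T \<inter> g2 -` u2)"
      using u N(3) g1 g2 by (auto intro!: continuous_openin_preimage[of T _ C])
    then have W: "openin (top_of_set T) W" "y \<in> W"
      unfolding W_def using u y by (blast intro: openin_Int)+
    show ?thesis
    proof (cases "u1 = u2")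
      case True
      obtain q where "homeomorphism u1 N p q" using N(5) u(1) by blast
      then have "inj_on p u1" by (metis homeomorphism_apply1 inj_onI)
      then have "\<forall>w\<in>W. g1 w = g2 w"
        unfolding W_def using True lifts by (auto dest: inj_onD)
      then show ?thesis using W by blast
    next
      case False
      then have "disjnt u1 u2" using N(4) u by (auto simp: pairwise_def)
      then have "\<forall>w\<in>W. g1 w \<noteq> g2 w" unfolding W_def disjnt_def by auto
      then show ?thesis using W by blast
    qed
  qed
  define E where "E = {y\<in>T. g1 y = g2 y}"
  have "\<exists>W. openin (top_of_set T) W \<and> y \<in> W \<and> W \<subseteq> E" if "y \<in> E" for y
  proof -
    have "y \<in> T" using that by (simp add: E_def)
    obtain W where "openin (top_of_set T) W \<and> y \<in> W \<and>
        ((\<forall>w\<in>W. g1 w = g2 w) \<or> (\<forall>w\<in>W. g1 w \<noteq> g2 w))"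
      by (rule exE[OF sheets[OF \<open>y \<in> T\<close>]])
    then have W: "openin (top_of_set T) W" "y \<in> W"
        "(\<forall>w\<in>W. g1 w = g2 w) \<or> (\<forall>w\<in>W. g1 w \<noteq> g2 w)" by simp_all
    then have "W \<subseteq> E" using that openin_imp_subset[OF W(1)] unfolding E_def by auto
    then show ?thesis using W by blast
  qed
  then have "openin (top_of_set T) E" by (subst openin_subopen) blast
  moreover have "\<exists>W. openin (top_of_set T) W \<and> y \<in> W \<and> W \<subseteq> T - E" if "y \<in> T - E" for y
  proof -
    have "y \<in> T" using that by (simp add: E_def)
    obtain W where "openin (top_of_set T) W \<and> y \<in> W \<and>
        ((\<forall>w\<in>W. g1 w = g2 w) \<or> (\<forall>w\<in>W. g1 w \<noteq> g2 w))"
      by (rule exE[OF sheets[OF \<open>y \<in> T\<close>]])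
    then have W: "openin (top_of_set T) W" "y \<in> W"
        "(\<forall>w\<in>W. g1 w = g2 w) \<or> (\<forall>w\<in>W. g1 w \<noteq> g2 w)" by simp_all
    then have "W \<subseteq> T - E" using that openin_imp_subset[OF W(1)] unfolding E_def by auto
    then show ?thesis using W by blast
  qed
  then have "openin (top_of_set T) (T - E)" by (subst openin_subopen) blast
  then have "closedin (top_of_set T) E"
    by (simp add: closedin_def E_def)
  ultimately have "E = {} \<or> E = T"
    using \<open>connected T\<close> by (auto simp: connected_clopen)
  then show ?thesis using assms unfolding E_def by blast
qed

lemma convex_UN_ball:
  fixes S :: "'a::real_normed_vector set"
  assumes "convex S"
  shows "convex (\<Union>x\<in>S. ball x e)"
proof -
  have "(\<Union>x\<in>S. ball x e) = (\<Union>x\<in>S. \<Union>y\<in>ball 0 e. {x + y})" (is "?l = ?r")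
  proof
    show "?l \<subseteq> ?r"
    proof
      fix w assume "w \<in> ?l"
      then obtain x where "x \<in> S" "dist x w < e" by auto
      then have "w = x + (w - x)" "w - x \<in> ball 0 e" by (auto simp: dist_norm norm_minus_commute)
      then show "w \<in> ?r" using \<open>x \<in> S\<close> by blast
    qed
  qed (auto simp: dist_norm)
  then show ?thesis using convex_sums[OF assms convex_ball[of 0 e]] by simp
qed

text \<open>
  The lift is built on a convex open neighbourhood of the segment so that lifts for different
  end points \<open>w\<close> can be compared: the intersection of two such neighbourhoods is convex, hence
  connected. The set of times up to which such a lift exists is open and closed in the unit interval.
  For closedness, the lift up to a nearby earlier time \<open>s\<close> is continued by a sheet over a ball, after
  both neighbourhoods have been shrunk to tubes of a common radius, whose union is again convex.
\<close>

lemma covering_lift_along_segment: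
  fixes p :: "'a::topological_space \<Rightarrow> 'b::topological_space"
    and f :: "'c::euclidean_space \<Rightarrow> 'b"
  assumes cov: "covering_space C p S" and "a \<in> C" "open U"
    and f: "continuous_on U f" "f ` U \<subseteq> S" "f z = p a"
    and seg: "closed_segment z w \<subseteq> U"
  shows "\<exists>V g. open V \<and> convex V \<and> closed_segment z w \<subseteq> V \<and> V \<subseteq> U \<and> continuous_on V g \<and>
           g ` V \<subseteq> C \<and> g z = a \<and> (\<forall>y\<in>V. p (g y) = f y)"
proof -
  define \<gamma> where "\<gamma> t = z + t *\<^sub>R (w - z)" for t :: real
  define P where "P t \<longleftrightarrow> (\<exists>V g. open V \<and> convex V \<and> closed_segment z (\<gamma> t) \<subseteq> V \<and> V \<subseteq> U \<and>
      continuous_on V g \<and> g ` V \<subseteq> C \<and> g z = a \<and> (\<forall>y\<in>V. p (g y) = f y))" for t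
  have \<gamma>_in: "\<gamma> t \<in> U" if "t \<in> {0..1}" for t
    using that seg unfolding \<gamma>_def closed_segment_def
    by (force simp: algebra_simps)
  have sub: "\<gamma> s \<in> closed_segment z (\<gamma> t)" if "0 \<le> s" "s \<le> t" for s t
  proof (cases "t = 0")
    case False
    then show ?thesis using that unfolding \<gamma>_def in_segment
      by (intro exI[of _ "s/t"]) (auto simp: algebra_simps)
  qed (use that in \<open>auto simp: \<gamma>_def\<close>)
  have cont\<gamma>: "continuous_on A \<gamma>" for A unfolding \<gamma>_def by (intro continuous_intros)
  have sheet: "\<exists>e>0. ball (\<gamma> t) e \<subseteq> U \<and> (\<forall>y b. y \<in> ball (\<gamma> t) e \<longrightarrow> b \<in> C \<longrightarrow> p b = f y \<longrightarrow>
      (\<exists>g. continuous_on (ball (\<gamma> t) e) g \<and> g ` ball (\<gamma> t) e \<subseteq> C \<and> g y = b \<and>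
           (\<forall>y\<in>ball (\<gamma> t) e. p (g y) = f y)))"
    if t: "t \<in> {0..1}" for t
  proof -
    have "f (\<gamma> t) \<in> S" using \<gamma>_in[OF t] f(2) by blast
    then obtain N v where N: "f (\<gamma> t) \<in> N" "openin (top_of_set S) N" "\<Union>v = C \<inter> p -` N"
        "\<And>u. u \<in> v \<Longrightarrow> openin (top_of_set C) u"
        "\<And>u. u \<in> v \<Longrightarrow> \<exists>q. homeomorphism u N p q"
      using evenly_covered[OF cov] by metis
    have "openin (top_of_set U) (U \<inter> f -` N)"
      using f N(2) by (intro continuous_openin_preimage[of U f S N]) auto
    then have "open (U \<inter> f -` N)" using \<open>open U\<close> by (rule openin_open_trans)
    then obtain e where e: "e > 0" "ball (\<gamma> t) e \<subseteq> U \<inter> f -` N"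
      using \<gamma>_in[OF t] N(1) by (metis IntI openE vimageI)
    show ?thesis
    proof (intro exI[of _ e] conjI allI impI)
      fix y b assume y: "y \<in> ball (\<gamma> t) e" and b: "b \<in> C" "p b = f y"
      then have "b \<in> \<Union>v" using e N(3) by auto
      then obtain u where u: "u \<in> v" "b \<in> u" by blast
      then obtain q where q: "homeomorphism u N p q" using N(5) by blast
      have "u \<subseteq> C" using N(3) u by blast
      have fN: "f ` ball (\<gamma> t) e \<subseteq> N" using e by blast
      have qN: "q ` N = u" "continuous_on N q" using q unfolding homeomorphism_def by blast+
      have "continuous_on (ball (\<gamma> t) e) (q \<circ> f)"
        using e fN f(1) qN(2) by (meson continuous_on_compose continuous_on_subset le_inf_iff)
      moreover have "(q \<circ> f) ` ball (\<gamma> t) e \<subseteq> C"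
        using fN qN(1) \<open>u \<subseteq> C\<close> by fastforce
      moreover have "(q \<circ> f) y = b"
        using homeomorphism_apply1[OF q u(2)] b by simp
      moreover have "\<forall>y\<in>ball (\<gamma> t) e. p ((q \<circ> f) y) = f y"
        using fN homeomorphism_apply2[OF q] by auto
      ultimately show "\<exists>g. continuous_on (ball (\<gamma> t) e) g \<and> g ` ball (\<gamma> t) e \<subseteq> C \<and> g y = b \<and>
           (\<forall>y\<in>ball (\<gamma> t) e. p (g y) = f y)" by blast
    qed (use e in auto)
  qed
  define A where "A = {t\<in>{0..1}. P t}"
  have "P 0"
  proof -
    have \<gamma>0: "\<gamma> 0 = z" by (simp add: \<gamma>_def)
    obtain e where e: "e > 0" "ball z e \<subseteq> U" and ex: "\<And>y b. y \<in> ball z e \<longrightarrow> b \<in> C \<longrightarrow> p b = f y \<longrightarrow>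
      (\<exists>g. continuous_on (ball z e) g \<and> g ` ball z e \<subseteq> C \<and> g y = b \<and> (\<forall>y\<in>ball z e. p (g y) = f y))"
      using sheet[of 0, unfolded \<gamma>0] by auto
    have "z \<in> ball z e" using e by simp
    then obtain g where g: "continuous_on (ball z e) g \<and> g ` ball z e \<subseteq> C \<and> g z = a \<and>
           (\<forall>y\<in>ball z e. p (g y) = f y)" using ex[of z a] \<open>a \<in> C\<close> f(3) by auto
    show ?thesis unfolding P_def
      by (rule exI[of _ "ball z e"], rule exI[of _ g]) (use g e in \<open>auto simp: \<gamma>_def\<close>)
  qed
  have "openin (top_of_set {0..1}) A"
  proof (subst openin_subopen, intro ballI)
    fix t assume t: "t \<in> A"
    then obtain V g where V: "open V" "convex V" "closed_segment z (\<gamma> t) \<subseteq> V" "V \<subseteq> U"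
      "continuous_on V g" "g ` V \<subseteq> C" "g z = a" "\<forall>y\<in>V. p (g y) = f y"
      unfolding A_def P_def by blast
    have "openin (top_of_set {0..1}) ({0..1} \<inter> \<gamma> -` V)"
      using cont\<gamma> V(1) by (rule continuous_openin_preimage_gen)
    moreover have "{0..1} \<inter> \<gamma> -` V \<subseteq> A"
    proof
      fix s assume s: "s \<in> {0..1} \<inter> \<gamma> -` V"
      then have "closed_segment z (\<gamma> s) \<subseteq> V"
        using V(2,3) by (intro closed_segment_subset) auto
      then show "s \<in> A" using V s unfolding A_def P_def by blast
    qed
    ultimately show "\<exists>W. openin (top_of_set {0..1}) W \<and> t \<in> W \<and> W \<subseteq> A"
      using t V(3) unfolding A_def by (intro exI[of _ "{0..1} \<inter> \<gamma> -` V"]) auto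
  qed
  moreover have "openin (top_of_set {0..1}) ({0..1} - A)"
  proof (subst openin_subopen, intro ballI)
    fix t assume t: "t \<in> {0..1} - A"
    then obtain e where e: "e > 0" "ball (\<gamma> t) e \<subseteq> U" and
      ex: "\<And>y b. y \<in> ball (\<gamma> t) e \<Longrightarrow> b \<in> C \<Longrightarrow> p b = f y \<Longrightarrow>
      (\<exists>g. continuous_on (ball (\<gamma> t) e) g \<and> g ` ball (\<gamma> t) e \<subseteq> C \<and> g y = b \<and>
           (\<forall>y\<in>ball (\<gamma> t) e. p (g y) = f y))"
      using sheet[of t] by auto
    let ?W = "{0..1} \<inter> \<gamma> -` ball (\<gamma> t) e"
    have "openin (top_of_set {0..1}) ?W"
      using cont\<gamma> by (rule continuous_openin_preimage_gen) simp
    moreover have "?W \<inter> A = {}"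
    proof (rule ccontr)
      assume "?W \<inter> A \<noteq> {}"
      then obtain s where s: "s \<in> {0..1}" "\<gamma> s \<in> ball (\<gamma> t) e" "P s" unfolding A_def by blast
      then obtain V g1 where V: "open V" "convex V" "closed_segment z (\<gamma> s) \<subseteq> V" "V \<subseteq> U"
        "continuous_on V g1" "g1 ` V \<subseteq> C" "g1 z = a" "\<forall>y\<in>V. p (g1 y) = f y"
        unfolding P_def by blast
      have "P t"
      proof (cases "t \<le> s")
        case True
        then have "\<gamma> t \<in> V" using sub[of t s] t V(3) by auto
        then have "closed_segment z (\<gamma> t) \<subseteq> V"
          using V(2,3) by (intro closed_segment_subset) auto
        then show ?thesis unfolding P_def using V by blast
      next
        case False
        have "\<gamma> s \<in> V" using V(3) by auto
        then have "g1 (\<gamma> s) \<in> C" "p (g1 (\<gamma> s)) = f (\<gamma> s)" using V(6,8) by auto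
        then obtain g2 where g2: "continuous_on (ball (\<gamma> t) e) g2" "g2 ` ball (\<gamma> t) e \<subseteq> C"
            "g2 (\<gamma> s) = g1 (\<gamma> s)" "\<forall>y\<in>ball (\<gamma> t) e. p (g2 y) = f y"
          using ex[OF s(2)] by blast
        have "closed_segment (\<gamma> s) (\<gamma> t) \<subseteq> ball (\<gamma> t) e"
          using s(2) e(1) by (intro closed_segment_subset) auto
        then obtain e2 where e2: "e2 > 0" "(\<Union>x\<in>closed_segment (\<gamma> s) (\<gamma> t). ball x e2) \<subseteq> ball (\<gamma> t) e"
          using compact_subset_open_imp_ball_epsilon_subset[OF compact_segment open_ball] by metis
        obtain e1 where e1: "e1 > 0" "(\<Union>x\<in>closed_segment z (\<gamma> s). ball x e1) \<subseteq> V"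
          using compact_subset_open_imp_ball_epsilon_subset[OF compact_segment V(1) V(3)] by metis
        define r where "r = min e1 e2"
        define N1 where "N1 = (\<Union>x\<in>closed_segment z (\<gamma> s). ball x r)"
        define N2 where "N2 = (\<Union>x\<in>closed_segment (\<gamma> s) (\<gamma> t). ball x r)"
        have "r > 0" using e1 e2 by (simp add: r_def)
        have ball_r: "ball x r \<subseteq> ball x e1" "ball x r \<subseteq> ball x e2" "x \<in> ball x r" for x
          using \<open>r > 0\<close> by (auto simp: r_def)
        have N1: "N1 \<subseteq> V" "open N1" "convex N1" "closed_segment z (\<gamma> s) \<subseteq> N1"
          using e1(2) ball_r unfolding N1_def by (blast, auto intro!: convex_UN_ball)
        have N2: "N2 \<subseteq> ball (\<gamma> t) e" "open N2" "convex N2" "closed_segment (\<gamma> s) (\<gamma> t) \<subseteq> N2"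
          using e2(2) ball_r unfolding N2_def by (blast, auto intro!: convex_UN_ball)
        have "closed_segment z (\<gamma> s) \<union> closed_segment (\<gamma> s) (\<gamma> t) = closed_segment z (\<gamma> t)"
          using sub[of s t] s(1) False by (intro Un_closed_segment) auto
        then have N12: "N1 \<union> N2 = (\<Union>x\<in>closed_segment z (\<gamma> t). ball x r)"
          unfolding N1_def N2_def by blast
        define g where "g y = (if y \<in> N1 then g1 y else g2 y)" for y
        have agree: "g1 y = g2 y" if "y \<in> N1 \<inter> N2" for y
        proof (rule covering_lifts_agree[OF cov, of "N1 \<inter> N2" g1 g2 "\<gamma> s"])
          show "connected (N1 \<inter> N2)" using N1(3) N2(3) by (intro convex_connected convex_Int)
          show "continuous_on (N1 \<inter> N2) g1" "continuous_on (N1 \<inter> N2) g2"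
            using N1(1) N2(1) V(5) g2(1) by (auto intro: continuous_on_subset)
        qed (use that N1 N2 V g2 in \<open>auto 0 4\<close>)
        have "continuous_on N1 g"
          using V(5) N1(1) by (simp add: g_def continuous_on_subset)
        moreover have "continuous_on N2 g"
          using continuous_on_subset[OF g2(1) N2(1)]
          by (rule continuous_on_eq) (use agree in \<open>auto simp: g_def\<close>)
        ultimately have "continuous_on (N1 \<union> N2) g"
          using N1(2) N2(2) by (simp add: continuous_on_open_Un)
        moreover have "convex (N1 \<union> N2)" unfolding N12 by (rule convex_UN_ball) simp
        moreover have "closed_segment z (\<gamma> t) \<subseteq> N1 \<union> N2" unfolding N12 using \<open>r > 0\<close> by auto
        moreover have "g z = a" using N1(4) V(7) by (auto simp: g_def)
        moreover have "g ` (N1 \<union> N2) \<subseteq> C" "\<forall>y\<in>N1 \<union> N2. p (g y) = f y"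
          using V(6,8) g2(2,4) N1(1) N2(1) by (auto simp: g_def image_subset_iff subset_iff)
        ultimately show ?thesis unfolding P_def
          using N1(1,2) N2(1,2) V(4) e(2)
          by (intro exI[of _ "N1 \<union> N2"] exI[of _ g]) (auto intro: open_Un)
      qed
      then show False using t unfolding A_def by auto
    qed
    ultimately show "\<exists>W. openin (top_of_set {0..1}) W \<and> t \<in> W \<and> W \<subseteq> {0..1} - A"
      using t e(1) by (intro exI[of _ ?W]) auto
  qed
  ultimately have "A = {} \<or> A = {0..1}"
    using connected_Icc[of "0::real" 1] by (auto simp: connected_clopen closedin_def A_def)
  moreover have "0 \<in> A" using \<open>P 0\<close> by (simp add: A_def)
  ultimately have "1 \<in> A" by auto
  then have "P 1" by (simp add: A_def)
  then show ?thesis unfolding P_def \<gamma>_def by simp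
qed

text \<open>
  The lifts along the segments from \<open>z\<close> agree where they overlap and so combine to one map.
\<close>

lemma covering_lift_starlike:
  fixes p :: "'a::topological_space \<Rightarrow> 'b::topological_space"
    and f :: "'c::euclidean_space \<Rightarrow> 'b"
  assumes cov: "covering_space C p S" and "a \<in> C" "open U"
    and f: "continuous_on U f" "f ` U \<subseteq> S" "f z = p a"
    and star: "\<And>w. w \<in> U \<Longrightarrow> closed_segment z w \<subseteq> U" and "z \<in> U"
  obtains g where "continuous_on U g" "g ` U \<subseteq> C" "g z = a" "\<And>y. y \<in> U \<Longrightarrow> p (g y) = f y"
proof -
  have "\<forall>w\<in>U. \<exists>V g. open V \<and> convex V \<and> closed_segment z w \<subseteq> V \<and> V \<subseteq> U \<and> continuous_on V g \<and>
           g ` V \<subseteq> C \<and> g z = a \<and> (\<forall>y\<in>V. p (g y) = f y)"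
    using covering_lift_along_segment[OF cov \<open>a \<in> C\<close> \<open>open U\<close> f star] by blast
  then obtain V g where Vg: "\<And>w. w \<in> U \<Longrightarrow> open (V w) \<and> convex (V w) \<and> closed_segment z w \<subseteq> V w \<and>
      V w \<subseteq> U \<and> continuous_on (V w) (g w) \<and> g w ` V w \<subseteq> C \<and> g w z = a \<and> (\<forall>y\<in>V w. p (g w y) = f y)"
    by metis
  define l where "l w = g w w" for w
  have l: "l y = g w y" if w: "w \<in> U" and y: "y \<in> V w" for w y
  proof -
    have yU: "y \<in> U" using Vg[OF w] y by blast
    have zw: "z \<in> V w" and zy: "z \<in> V y" and yy: "y \<in> V y" using Vg[OF w] Vg[OF yU] by auto
    show ?thesis unfolding l_def
    proof (rule covering_lifts_agree[OF cov, of "V y \<inter> V w" "g y" "g w" z])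
      show "connected (V y \<inter> V w)"
        using Vg[OF w] Vg[OF yU] by (intro convex_connected convex_Int) auto
      show "continuous_on (V y \<inter> V w) (g y)" "continuous_on (V y \<inter> V w) (g w)"
        using Vg[OF w] Vg[OF yU] by (auto intro: continuous_on_subset)
    qed (use Vg[OF w] Vg[OF yU] zw zy yy y in auto)
  qed
  have in_V: "w \<in> V w" if "w \<in> U" for w using Vg[OF that] by auto
  have "V w \<subseteq> U" if "w \<in> U" for w using Vg[OF that] by simp
  then have "U = (\<Union>w\<in>U. V w)" using in_V by fast
  moreover have "continuous_on (\<Union>w\<in>U. V w) l"
  proof (rule continuous_on_open_UN)
    show "continuous_on (V w) l" if "w \<in> U" for w
      by (rule continuous_on_eq[of _ "g w"]) (use Vg[OF that] l[OF that] in auto)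
  qed (use Vg in auto)
  ultimately have "continuous_on U l" by simp
  moreover have "l w \<in> C \<and> p (l w) = f w" if "w \<in> U" for w
    unfolding l_def using Vg[OF that] in_V[OF that] by blast
  then have "l ` U \<subseteq> C" "\<And>y. y \<in> U \<Longrightarrow> p (l y) = f y" by auto
  moreover have "l z = a" unfolding l_def using Vg[OF \<open>z \<in> U\<close>] by auto
  ultimately show ?thesis using that by blast
qed

section \<open>Loops and maps to the circle\<close>

text \<open>
  This transports the homology of the sphere \<open>nsphere 1\<close>, whose points are real sequences, to the unit
  circle of the complex plane.
\<close>

lemma nontrivial_homology_circle:
  "\<not> trivial_group (homology_group 1 (top_of_set (sphere (0::complex) 1)))"
proof
  assume triv: "trivial_group (homology_group 1 (top_of_set (sphere (0::complex) 1)))"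
  let ?S = "top_of_set (sphere (0::complex) 1)"
  define f where "f z = (\<lambda>i::nat. if i = 0 then Re z else if i = 1 then Im z else 0)" for z
  define g where "g x = Complex (x 0) (x 1)" for x :: "nat \<Rightarrow> real"
  have circle: "cmod z = 1 \<longleftrightarrow> (Re z)\<^sup>2 + (Im z)\<^sup>2 = 1" for z
    by (simp add: cmod_def)
  have "continuous_map ?S (nsphere 1) f"
    unfolding nsphere continuous_map_in_subtopology continuous_map_componentwise_UNIV
  proof (intro conjI allI)
    show "continuous_map ?S euclideanreal (\<lambda>z. f z k)" for k
      unfolding f_def by (cases "k = 0"; cases "k = 1") (auto intro!: continuous_intros)
    show "f \<in> topspace ?S \<rightarrow> {x. (\<Sum>i\<le>1. (x i)\<^sup>2) = 1 \<and> (\<forall>i>1. x i = 0)}"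
      unfolding f_def by (auto simp: circle)
  qed
  moreover have "continuous_map (nsphere 1) ?S g"
  proof -
    have "continuous_map (nsphere 1) euclidean (\<lambda>x. of_real (x 0) + \<i> * of_real (x 1) :: complex)"
      by (intro continuous_map_add continuous_map_compose[OF continuous_map_nsphere_projection, unfolded comp_def])
        (auto intro!: continuous_intros)
    then have "continuous_map (nsphere 1) euclidean g"
      by (rule continuous_map_eq) (simp add: g_def Complex_eq)
    moreover have "g \<in> topspace (nsphere 1) \<rightarrow> sphere 0 1"
      by (auto simp: nsphere g_def circle)
    ultimately show ?thesis by (simp add: continuous_map_in_subtopology)
  qed
  moreover have "g (f z) = z" for z by (simp add: f_def g_def complex_eq_iff)
  moreover have "f (g x) = x" if "x \<in> topspace (nsphere 1)" for x
  proof
    show "f (g x) i = x i" for i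
      using that unfolding f_def g_def nsphere by (cases "i = 0"; cases "i = 1") auto
  qed
  ultimately have "homeomorphic_maps ?S (nsphere 1) f g"
    unfolding homeomorphic_maps_def by simp
  then have "?S homeomorphic_space nsphere 1" unfolding homeomorphic_space_def by blast
  then have "homology_group 1 ?S \<cong> homology_group 1 (nsphere 1)"
    by (rule homeomorphic_space_imp_isomorphic_homology_groups)
  then have "trivial_group (homology_group 1 (nsphere 1))"
    using triv isomorphic_group_triviality by (metis group_relative_homology_group)
  then have "trivial_group (reduced_homology_group (int 1) (nsphere 1))"
    by (simp add: un_reduced_homology_group)
  moreover have "reduced_homology_group (int 1) (nsphere 1) \<cong> integer_group"
    using reduced_homology_group_nsphere_aux[of "int 1" 1] by simp
  ultimately have "trivial_group integer_group"
    using isomorphic_group_triviality by (metis group_reduced_homology_group group_integer_group)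
  then have "(UNIV :: int set) = {0}"
    by (simp add: trivial_group_def integer_group_def)
  then have "(1::int) \<in> {0}" by blast
  then show False by simp
qed

text \<open>
  Otherwise the identity of the circle would be homotopic to a map that factors through \<open>X\<close>, and the
  identity of its first homology group would factor through the trivial group.
\<close>

lemma loop_not_mapped_to_circle_generator:
  fixes X :: "'a::topological_space set"
  assumes triv: "trivial_group (homology_group 1 (top_of_set X))"
    and \<gamma>: "path \<gamma>" "path_image \<gamma> \<subseteq> X" "pathfinish \<gamma> = pathstart \<gamma>"
    and \<theta>: "continuous_on X \<theta>" "\<theta> ` X \<subseteq> sphere (0::complex) 1"
  shows "\<not> homotopic_loops (sphere 0 1) (\<theta> \<circ> \<gamma>) (\<lambda>t. exp (2 * of_real pi * \<i> * of_real t))"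
proof
  let ?S = "sphere (0::complex) 1" and ?A = "\<lambda>z. Arg2pi z / (2 * pi)"
  let ?e = "\<lambda>t. exp (2 * of_real pi * \<i> * of_real t) :: complex"
  assume hom: "homotopic_loops ?S (\<theta> \<circ> \<gamma>) ?e"
  define c where "c = \<gamma> \<circ> ?A"
  have "homotopic_loops X \<gamma> \<gamma>" using \<gamma> by (simp add: homotopic_loops_refl)
  then have "homotopic_with_canon (\<lambda>h. True) ?S X c c"
    unfolding c_def by (rule homotopic_loops_imp_homotopic_circlemaps)
  then have c: "continuous_map (top_of_set ?S) (top_of_set X) c"
    by (simp add: homotopic_with_imp_continuous_maps)
  have \<theta>': "continuous_map (top_of_set X) (top_of_set ?S) \<theta>" using \<theta> by auto
  have "homotopic_with_canon (\<lambda>h. True) ?S ?S ((\<theta> \<circ> \<gamma>) \<circ> ?A) (?e \<circ> ?A)"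
    using hom by (rule homotopic_loops_imp_homotopic_circlemaps)
  then have "homotopic_with_canon (\<lambda>h. True) ?S ?S (\<theta> \<circ> c) id"
  proof (rule homotopic_with_eq)
    fix z :: complex assume "z \<in> topspace (top_of_set ?S)"
    then have "z = exp (\<i> * of_real (Arg2pi z))"
      using Arg2pi_eq[of z] by simp
    then show "id z = (?e \<circ> ?A) z" by (simp add: mult_ac)
  qed (auto simp: c_def o_assoc)
  then have eq: "hom_induced 1 (top_of_set ?S) {} (top_of_set ?S) {} (\<theta> \<circ> c)
        = hom_induced 1 (top_of_set ?S) {} (top_of_set ?S) {} id"
    by (rule homology_homotopy_empty)
  have "trivial_group (homology_group 1 (top_of_set ?S))"
  proof -
    let ?G = "homology_group 1 (top_of_set ?S)" and ?H = "homology_group 1 (top_of_set X)"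
    have "x = \<one>\<^bsub>?G\<^esub>" if x: "x \<in> carrier ?G" for x
    proof -
      have "x = hom_induced 1 (top_of_set X) {} (top_of_set ?S) {} \<theta>
          (hom_induced 1 (top_of_set ?S) {} (top_of_set X) {} c x)"
        using eq hom_induced_id[OF x] hom_induced_compose_empty[OF c \<theta>'] by (metis comp_apply)
      moreover have "hom_induced 1 (top_of_set ?S) {} (top_of_set X) {} c x \<in> carrier ?H"
        by (rule hom_induced_carrier)
      then have "hom_induced 1 (top_of_set ?S) {} (top_of_set X) {} c x = \<one>\<^bsub>?H\<^esub>"
        using triv by (simp add: trivial_group_def)
      ultimately show ?thesis
        using hom_one[OF hom_induced_empty_hom group_relative_homology_group group_relative_homology_group]
        by metis
    qed
    then have "carrier ?G \<subseteq> {\<one>\<^bsub>?G\<^esub>}" by blast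
    then show ?thesis
      using group.trivial_group_alt[OF group_relative_homology_group] by blast
  qed
  then show False using nontrivial_homology_circle by blast
qed

lemma homotopic_circle_loop_of_angle:
  assumes h: "continuous_on {0..1} h" "h 0 = 0" "h 1 = 2 * pi"
    and f: "\<And>t. t \<in> {0..1} \<Longrightarrow> f t = exp (\<i> * of_real (h t))"
  shows "homotopic_loops (sphere 0 1) f (\<lambda>t. exp (2 * of_real pi * \<i> * of_real t))"
proof -
  define k where "k z = exp (\<i> * of_real ((1 - fst z) * h (snd z) + fst z * (2 * pi * snd z)))"
    for z :: "real \<times> real"
  have "continuous_on ({0..1} \<times> {0..1}) (\<lambda>z. h (snd z))"
    by (rule continuous_on_compose2[OF h(1)]) (auto intro!: continuous_intros)
  then have "continuous_on ({0..1} \<times> {0..1}) k"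
    unfolding k_def by (intro continuous_intros)
  moreover have "k ` ({0..1} \<times> {0..1}) \<subseteq> sphere 0 1"
    by (auto simp: k_def)
  moreover have "\<forall>t\<in>{0..1}. k (0, t) = f t"
    using f by (simp add: k_def)
  moreover have "\<forall>t\<in>{0..1}. k (1, t) = exp (2 * of_real pi * \<i> * of_real t)"
    by (simp add: k_def mult_ac)
  moreover have "pathfinish (k \<circ> Pair s) = pathstart (k \<circ> Pair s)" for s
  proof -
    have "(1 - s) * (2 * pi) + s * (2 * pi) = 2 * pi" by (simp add: algebra_simps)
    then have "k (s, 1) = exp (\<i> * of_real (2 * pi))" unfolding k_def fst_conv snd_conv h(3) by simp
    also have "\<dots> = 1" using exp_two_pi_i by (simp add: mult_ac)
    also have "\<dots> = k (s, 0)" by (simp add: k_def h(2))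
    finally show ?thesis by (simp add: pathfinish_def pathstart_def)
  qed
  ultimately show ?thesis
    unfolding homotopic_loops image_subset_iff_funcset by (intro exI[of _ k]) blast
qed


section \<open>Local homeomorphisms and their finite fibres\<close>

definition local_homeomorphism :: "'a::topological_space set \<Rightarrow> ('a \<Rightarrow> 'b::topological_space) \<Rightarrow> bool" where
  "local_homeomorphism X F \<longleftrightarrow>
     (\<forall>x\<in>X. \<exists>U V g. x \<in> U \<and> openin (top_of_set X) U \<and> open V \<and> homeomorphism U V F g)"

lemma local_homeomorphism_continuous:
  assumes "local_homeomorphism X F"
  shows "continuous_on X F"
  unfolding continuous_on_def
proof
  fix x assume "x \<in> X"
  then obtain U V g where U: "x \<in> U" "openin (top_of_set X) U" "homeomorphism U V F g"
    using assms unfolding local_homeomorphism_def by meson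
  then obtain T where T: "open T" "U = X \<inter> T" by (auto simp: openin_open)
  have "(F \<longlongrightarrow> F x) (at x within U)"
    using homeomorphism_cont1[OF U(3)] U(1) by (simp add: continuous_on_def)
  moreover have "at x within U = at x within X"
    using U(1) T by (intro at_within_nhd[of x T]) auto
  ultimately show "(F \<longlongrightarrow> F x) (at x within X)" by simp
qed

text \<open>
  The points of a finite part of a fibre are separated by disjoint open sets, and the local inverses
  at these points are restricted to a common ball over which they stay in these sets.
\<close>

lemma disjoint_local_sections:
  fixes X :: "'a::topological_space set" and F :: "'a \<Rightarrow> 'b::metric_space"
  assumes haus: "Hausdorff_space (top_of_set X)" and lh: "local_homeomorphism X F"
    and P: "finite P" "P \<subseteq> X" "\<And>x. x \<in> P \<Longrightarrow> F x = y" and "0 < r0"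
  obtains r s where "0 < r" "r \<le> r0"
    "\<And>x. x \<in> P \<Longrightarrow> continuous_on (ball y r) (s x)"
    "\<And>x. x \<in> P \<Longrightarrow> s x y = x"
    "\<And>x v. x \<in> P \<Longrightarrow> v \<in> ball y r \<Longrightarrow> F (s x v) = v"
    "\<And>x. x \<in> P \<Longrightarrow> openin (top_of_set X) (s x ` ball y r)"
    "\<And>x x' v. x \<in> P \<Longrightarrow> x' \<in> P \<Longrightarrow> v \<in> ball y r \<Longrightarrow> s x v = s x' v \<Longrightarrow> x = x'"
proof -
  have "\<forall>x x'. x \<in> P \<and> x' \<in> P \<and> x \<noteq> x' \<longrightarrow>
      (\<exists>A B. openin (top_of_set X) A \<and> openin (top_of_set X) B \<and> x \<in> A \<and> x' \<in> B \<and> disjnt A B)"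
    using haus P(2) unfolding Hausdorff_space_def by (simp add: subset_iff)
  then obtain A B where AB: "\<And>x x'. x \<in> P \<Longrightarrow> x' \<in> P \<Longrightarrow> x \<noteq> x' \<Longrightarrow>
      openin (top_of_set X) (A x x') \<and> openin (top_of_set X) (B x x') \<and>
      x \<in> A x x' \<and> x' \<in> B x x' \<and> disjnt (A x x') (B x x')" by metis
  define N where "N x = X \<inter> \<Inter>((\<lambda>x'. A x x' \<inter> B x' x) ` (P - {x}))" for x
  have N: "openin (top_of_set X) (N x)" "x \<in> N x" if "x \<in> P" for x
  proof -
    have "openin (top_of_set X) (A x x' \<inter> B x' x)" if "x' \<in> P - {x}" for x'
      using AB[of x x'] AB[of x' x] \<open>x \<in> P\<close> that by (auto intro: openin_Int)
    then have "openin (top_of_set X) (topspace (top_of_set X) \<inter> (\<Inter>x'\<in>P - {x}. A x x' \<inter> B x' x))"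
      using P(1) by (intro openin_Int_Inter) auto
    then show "openin (top_of_set X) (N x)" by (simp add: N_def)
    show "x \<in> N x" unfolding N_def using AB[OF that] AB[OF _ that] P(2) that by auto
  qed
  have N_disj: "N x \<inter> N x' = {}" if "x \<in> P" "x' \<in> P" "x \<noteq> x'" for x x'
  proof -
    have "N x \<subseteq> A x x'" "N x' \<subseteq> B x x'" unfolding N_def using that by auto
    then show ?thesis using AB[OF that] unfolding disjnt_def by blast
  qed
  have "\<forall>x\<in>P. \<exists>U V g. x \<in> U \<and> openin (top_of_set X) U \<and> open V \<and> homeomorphism U V F g"
    using lh P(2) unfolding local_homeomorphism_def by blast
  then obtain U V g where UV: "\<And>x. x \<in> P \<Longrightarrow> x \<in> U x \<and> openin (top_of_set X) (U x) \<and> open (V x)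
      \<and> homeomorphism (U x) (V x) F (g x)" by metis
  define W where "W x = U x \<inter> N x" for x
  have "\<exists>\<rho>>0. ball y \<rho> \<subseteq> F ` W x" if x: "x \<in> P" for x
  proof -
    have hom: "homeomorphism (U x) (V x) F (g x)" using UV[OF x] by blast
    have "U x \<subseteq> X" using UV[OF x] openin_imp_subset by blast
    then have "openin (top_of_set (U x)) (W x)"
      using N(1)[OF x] unfolding W_def openin_open by blast
    then have "openin (top_of_set (V x)) (F ` W x)" by (rule homeomorphism_imp_open_map[OF hom])
    then have "open (F ` W x)" using UV[OF x] openin_open_trans by blast
    moreover have "y \<in> F ` W x" using P(3)[OF x] N(2)[OF x] UV[OF x] unfolding W_def by blast
    ultimately show ?thesis by (meson openE)
  qed
  then obtain \<rho> where \<rho>: "\<And>x. x \<in> P \<Longrightarrow> \<rho> x > 0 \<and> ball y (\<rho> x) \<subseteq> F ` W x" by metis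
  define r where "r = Min (insert r0 (\<rho> ` P))"
  have r: "0 < r" "r \<le> r0" "\<And>x. x \<in> P \<Longrightarrow> r \<le> \<rho> x"
    using P(1) \<rho> \<open>0 < r0\<close> unfolding r_def by (auto simp: Min_gr_iff)
  have gW: "g x v \<in> W x \<and> F (g x v) = v \<and> v \<in> V x" if x: "x \<in> P" and v: "v \<in> ball y r" for x v
  proof -
    have hom: "homeomorphism (U x) (V x) F (g x)" using UV[OF x] by blast
    have "v \<in> F ` W x" using \<rho>[OF x] r(3)[OF x] v by auto
    then obtain w where w: "w \<in> W x" "v = F w" by blast
    then have "w \<in> U x" by (simp add: W_def)
    then have "g x v = w" "v \<in> V x"
      using w homeomorphism_apply1[OF hom] homeomorphism_image1[OF hom] by auto
    then show ?thesis using w by simp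
  qed
  show ?thesis
  proof (rule that[of r g])
    show "0 < r" "r \<le> r0" by (rule r)+
    fix x assume x: "x \<in> P"
    have hom: "homeomorphism (U x) (V x) F (g x)" using UV[OF x] by blast
    have bV: "ball y r \<subseteq> V x" using gW[OF x] by blast
    show cont: "continuous_on (ball y r) (g x)"
      using homeomorphism_cont2[OF hom] bV continuous_on_subset by blast
    show "g x y = x" using homeomorphism_apply1[OF hom, of x] UV[OF x] P(3)[OF x] by simp
    show "F (g x v) = v" if "v \<in> ball y r" for v using gW[OF x that] by simp
    have "openin (top_of_set (V x)) (ball y r)" 
      unfolding openin_open using bV by (intro exI[of _ "ball y r"]) auto
    then have "openin (top_of_set (U x)) (g x ` ball y r)"
      by (rule homeomorphism_imp_open_map[OF homeomorphism_symD[OF hom]])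
    then show "openin (top_of_set X) (g x ` ball y r)" using UV[OF x] openin_trans by blast
    show "x = x'" if "x' \<in> P" "v \<in> ball y r" "g x v = g x' v" for x' v
    proof (rule ccontr)
      assume "x \<noteq> x'"
      have "g x v \<in> N x \<inter> N x'" using gW[OF x that(2)] gW[OF that(1,2)] that(3) by (simp add: W_def)
      then show False using N_disj[OF x that(1) \<open>x \<noteq> x'\<close>] by blast
    qed
  qed
qed

text \<open>
  The local sections through the points over \<open>y\<close> take distinct values over a nearby point outside
  \<open>D\<close>.
\<close>

lemma fibre_card_le_nearby:
  fixes X :: "'a::topological_space set" and F :: "'a \<Rightarrow> 'b::euclidean_space"
  assumes haus: "Hausdorff_space (top_of_set X)" and lh: "local_homeomorphism X F"
    and "finite D" and n: "\<And>v. v \<notin> D \<Longrightarrow> finite {x\<in>X. F x = v} \<and> card {x\<in>X. F x = v} = n"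
  shows "finite {x\<in>X. F x = y} \<and> card {x\<in>X. F x = y} \<le> n"
proof (rule finite_if_finite_subsets_card_bdd)
  fix P assume P: "P \<subseteq> {x\<in>X. F x = y}" "finite P"
  then have "P \<subseteq> X" "\<And>x. x \<in> P \<Longrightarrow> F x = y" by auto
  then obtain r s where rs: "0 < r" "r \<le> 1"
    "\<And>x. x \<in> P \<Longrightarrow> continuous_on (ball y r) (s x)"
    "\<And>x. x \<in> P \<Longrightarrow> s x y = x"
    "\<And>x v. x \<in> P \<Longrightarrow> v \<in> ball y r \<Longrightarrow> F (s x v) = v"
    "\<And>x. x \<in> P \<Longrightarrow> openin (top_of_set X) (s x ` ball y r)"
    "\<And>x x' v. x \<in> P \<Longrightarrow> x' \<in> P \<Longrightarrow> v \<in> ball y r \<Longrightarrow> s x v = s x' v \<Longrightarrow> x = x'"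
    using disjoint_local_sections[OF haus lh P(2), of y 1] zero_less_one by blast
  have "\<not> ball y r \<subseteq> D"
    using rs(1) \<open>finite D\<close> finite_imp_not_open[of "ball y r"] finite_subset by (metis ball_eq_empty not_le open_ball)
  then obtain v where v: "v \<in> ball y r" "v \<notin> D" by blast
  have "s x v \<in> X" if "x \<in> P" for x using openin_imp_subset[OF rs(6)[OF that]] v(1) by blast
  then have "(\<lambda>x. s x v) ` P \<subseteq> {x\<in>X. F x = v}" using rs(5) v by auto
  moreover have "inj_on (\<lambda>x. s x v) P" using rs(7) v by (auto intro: inj_onI)
  ultimately show "card P \<le> n" using n[OF v(2)] card_inj_on_le by metis
qed

text \<open>
  The images of the disjoint local sections through the points over \<open>y\<close> already contain \<open>n\<close> points
  of every nearby fibre, which leaves no room for points outside them.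
\<close>

lemma covering_space_of_constant_fibre_card:
  fixes X :: "'a::topological_space set" and F :: "'a \<Rightarrow> 'b::metric_space"
  assumes haus: "Hausdorff_space (top_of_set X)" and lh: "local_homeomorphism X F"
    and n: "\<And>v. finite {x\<in>X. F x = v} \<and> card {x\<in>X. F x = v} = n" and "0 < n"
  shows "covering_space X F UNIV"
proof
  show "continuous_on X F" using lh by (rule local_homeomorphism_continuous)
  show "F ` X = UNIV"
  proof -
    have "v \<in> F ` X" for v
    proof -
      have "{x\<in>X. F x = v} \<noteq> {}" using n[of v] \<open>0 < n\<close> by (metis card.empty less_irrefl)
      then show ?thesis by blast
    qed
    then show ?thesis by blast
  qed
  fix y :: 'b
  define P where "P = {x\<in>X. F x = y}"
  have P: "finite P" "P \<subseteq> X" "\<And>x. x \<in> P \<Longrightarrow> F x = y" "card P = n" using n[of y] by (auto simp: P_def)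
  obtain r s where rs: "0 < r" "r \<le> 1"
    "\<And>x. x \<in> P \<Longrightarrow> continuous_on (ball y r) (s x)"
    "\<And>x. x \<in> P \<Longrightarrow> s x y = x"
    "\<And>x v. x \<in> P \<Longrightarrow> v \<in> ball y r \<Longrightarrow> F (s x v) = v"
    "\<And>x. x \<in> P \<Longrightarrow> openin (top_of_set X) (s x ` ball y r)"
    "\<And>x x' v. x \<in> P \<Longrightarrow> x' \<in> P \<Longrightarrow> v \<in> ball y r \<Longrightarrow> s x v = s x' v \<Longrightarrow> x = x'"
    using disjoint_local_sections[OF haus lh P(1-3) zero_less_one] by blast
  let ?v = "(\<lambda>x. s x ` ball y r) ` P"
  have sX: "s x u \<in> X" if "x \<in> P" "u \<in> ball y r" for x u
    using openin_imp_subset[OF rs(6)[OF that(1)]] that(2) by blast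
  have "\<Union>?v = X \<inter> F -` ball y r"
  proof
    show "\<Union>?v \<subseteq> X \<inter> F -` ball y r" using sX rs(5) by auto
    show "X \<inter> F -` ball y r \<subseteq> \<Union>?v"
    proof
      fix z assume z: "z \<in> X \<inter> F -` ball y r"
      define u where "u = F z"
      have u: "u \<in> ball y r" using z by (simp add: u_def)
      have "(\<lambda>x. s x u) ` P \<subseteq> {x\<in>X. F x = u}" using sX rs(5) u by blast
      moreover have "inj_on (\<lambda>x. s x u) P" using rs(7) u by (auto intro: inj_onI)
      then have "card ((\<lambda>x. s x u) ` P) = card {x\<in>X. F x = u}"
        using n[of u] P(4) by (simp add: card_image)
      ultimately have "(\<lambda>x. s x u) ` P = {x\<in>X. F x = u}" using n[of u] by (metis card_subset_eq)
      moreover have "z \<in> {x\<in>X. F x = u}" using z by (simp add: u_def)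
      ultimately show "z \<in> \<Union>?v" using u by blast
    qed
  qed
  moreover have "pairwise disjnt ?v"
  proof (rule pairwiseI)
    fix A B assume "A \<in> ?v" "B \<in> ?v" "A \<noteq> B"
    then obtain x x' where x: "x \<in> P" "A = s x ` ball y r" "x' \<in> P" "B = s x' ` ball y r" "x \<noteq> x'" by blast
    have False if "u \<in> ball y r" "u' \<in> ball y r" "s x u = s x' u'" for u u'
    proof -
      have "u = u'" using that rs(5) x(1,3) by metis
      then show False using rs(7)[OF x(1,3) that(1)] that(3) x(5) by simp
    qed
    then show "disjnt A B" unfolding disjnt_def x(2,4) by blast
  qed
  moreover have "\<exists>q. homeomorphism A (ball y r) F q" if A: "A \<in> ?v" for A
  proof -
    obtain x where x: "x \<in> P" "A = s x ` ball y r" using A by blast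
    have "A \<subseteq> X" using sX x by blast
    have "homeomorphism A (ball y r) F (s x)"
    proof (rule homeomorphismI)
      show "continuous_on A F"
        using local_homeomorphism_continuous[OF lh] \<open>A \<subseteq> X\<close> by (rule continuous_on_subset)
    qed (use rs(3,5) x in auto)
    then show ?thesis by blast
  qed
  moreover have "\<forall>A\<in>?v. openin (top_of_set X) A" using rs(6) by blast
  ultimately show "\<exists>T. y \<in> T \<and> openin (top_of_set UNIV) T \<and>
      (\<exists>v. \<Union>v = X \<inter> F -` T \<and> (\<forall>u\<in>v. openin (top_of_set X) u) \<and>
           pairwise disjnt v \<and> (\<forall>u\<in>v. \<exists>q. homeomorphism u T F q))"
    using rs(1) by (intro exI[of _ "ball y r"] conjI exI[of _ ?v]) auto
qed

text \<open>
  If \<open>g\<close> is a lift of the identity, then \<open>g \<circ> F\<close> and the identity are both lifts of \<open>F\<close> through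
  \<open>F\<close> itself, so they agree as soon as they agree at one point.
\<close>

lemma connected_cover_of_euclidean_space_inj:
  fixes X :: "'a::topological_space set" and F :: "'a \<Rightarrow> 'b::euclidean_space"
  assumes cov: "covering_space X F UNIV" and "connected X"
  shows "inj_on F X"
proof (rule inj_onI)
  fix x y assume xy: "x \<in> X" "y \<in> X" "F x = F y"
  obtain g where g: "continuous_on UNIV g" "g ` UNIV \<subseteq> X" "g (F x) = x" "\<And>v. F (g v) = v"
    using covering_lift_starlike[OF cov xy(1) open_UNIV, of "\<lambda>v. v" "F x"] by auto
  have "g (F y) = y"
  proof (rule covering_lifts_agree[OF cov, of X "\<lambda>y. g (F y)" "\<lambda>y. y" x])
    show "continuous_on X (\<lambda>y. g (F y))"
      using continuous_on_compose2[OF g(1) covering_space_imp_continuous[OF cov]] by simp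
  qed (use g xy \<open>connected X\<close> in auto)
  then show "x = y" using g(3) xy(3) by simp
qed


section \<open>The fibre over a puncture\<close>

text \<open>
  Locally \<open>l\<close> is \<open>exp\<close>, which is open by invariance of domain, followed by a local inverse of \<open>G\<close>.
\<close>

lemma exp_lift_image_open:
  fixes X :: "'a::topological_space set" and G :: "'a \<Rightarrow> complex"
  assumes lh: "local_homeomorphism X G" and W: "open W" "inj_on exp W"
    and l: "continuous_on W l" "l ` W \<subseteq> X" "\<And>w. w \<in> W \<Longrightarrow> G (l w) = exp w"
  shows "openin (top_of_set X) (l ` W)"
proof (subst openin_subopen, clarify)
  fix w assume w: "w \<in> W"
  then have "l w \<in> X" using l(2) by blast
  then obtain U V g where U: "l w \<in> U" "openin (top_of_set X) U" "open V" "homeomorphism U V G g"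
    using lh unfolding local_homeomorphism_def by meson
  have UX: "U \<subseteq> X" using U(2) openin_imp_subset by blast
  define W' where "W' = W \<inter> l -` U"
  have "openin (top_of_set W) W'"
    unfolding W'_def using l(1,2) U(2) by (intro continuous_openin_preimage[of W l X]) auto
  then have "open W'" using W(1) openin_open_trans by blast
  moreover have "W' \<subseteq> W" unfolding W'_def by blast
  ultimately have "open (exp ` W')"
    using W(2) by (intro invariance_of_domain) (auto intro: continuous_intros inj_on_subset)
  then have "openin (top_of_set U) (U \<inter> G -` (exp ` W'))"
    using homeomorphism_cont1[OF U(4)] by (intro continuous_openin_preimage_gen)
  then have "openin (top_of_set X) (U \<inter> G -` (exp ` W'))" using U(2) openin_trans by blast
  moreover have "l w \<in> U \<inter> G -` (exp ` W')"
    using w U(1) l(3) unfolding W'_def by simp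
  moreover have "U \<inter> G -` (exp ` W') \<subseteq> l ` W"
  proof
    fix x assume x: "x \<in> U \<inter> G -` (exp ` W')"
    then obtain v where v: "v \<in> W" "l v \<in> U" "G x = exp v" unfolding W'_def by auto
    then have "G x = G (l v)" using l(3) by simp
    then have "x = l v" using homeomorphism_apply1[OF U(4)] x v(2) by (metis IntD1)
    then show "x \<in> l ` W" using v(1) by blast
  qed
  ultimately show "\<exists>T. openin (top_of_set X) T \<and> l w \<in> T \<and> T \<subseteq> l ` W" by blast
qed

lemma inj_on_exp_strip:
  assumes "\<delta> \<le> pi"
  shows "inj_on exp {w::complex. \<bar>Im w\<bar> < \<delta>}"
proof (rule inj_onI)
  fix v w :: complex assume "v \<in> {w. \<bar>Im w\<bar> < \<delta>}" "w \<in> {w. \<bar>Im w\<bar> < \<delta>}" "exp v = exp w"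
  have "Ln (exp u) = u" if "u \<in> {w. \<bar>Im w\<bar> < \<delta>}" for u
    using that assms by (simp add: Ln_exp)
  then show "v = w"
    using \<open>v \<in> _\<close> \<open>w \<in> _\<close> \<open>exp v = exp w\<close> by metis
qed

text \<open>
  The sector is cut out by the closed condition \<open>cos \<epsilon> * cmod z \<le> Re z\<close>, because the cosine
  decreases on \<open>[0, \<pi>]\<close>.
\<close>

lemma closed_sector:
  assumes "0 \<le> \<epsilon>" "\<epsilon> \<le> pi"
  shows "closed (insert 0 (exp ` {w::complex. \<bar>Im w\<bar> \<le> \<epsilon>}))"
proof -
  have "insert 0 (exp ` {w::complex. \<bar>Im w\<bar> \<le> \<epsilon>}) = {z. cos \<epsilon> * cmod z \<le> Re z}" (is "?l = ?r")
  proof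
    have "cos \<epsilon> * cmod (exp w) \<le> Re (exp w)" if "\<bar>Im w\<bar> \<le> \<epsilon>" for w
    proof -
      have "cos \<epsilon> \<le> cos \<bar>Im w\<bar>" using assms that by (intro cos_monotone_0_pi_le) auto
      then show ?thesis by (simp add: Re_exp mult.commute)
    qed
    then show "?l \<subseteq> ?r" by auto
    show "?r \<subseteq> ?l"
    proof
      fix z assume z: "z \<in> ?r"
      show "z \<in> ?l"
      proof (cases "z = 0")
        case False
        define w where "w = Ln z"
        have w: "z = exp w" "\<bar>Im w\<bar> \<le> pi"
          using False Im_Ln_le_pi[of z] mpi_less_Im_Ln[of z] by (auto simp: w_def)
        have "cos \<epsilon> * exp (Re w) \<le> cos \<bar>Im w\<bar> * exp (Re w)"
          using z w(1) by (simp add: Re_exp mult.commute)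
        then have "cos \<epsilon> \<le> cos \<bar>Im w\<bar>" by simp
        then have "\<bar>Im w\<bar> \<le> \<epsilon>" using assms w(2) cos_mono_le_eq[of \<epsilon> "\<bar>Im w\<bar>"] by simp
        then show ?thesis using w(1) by blast
      qed simp
    qed
  qed
  moreover have "closed {z. cos \<epsilon> * cmod z \<le> Re z}"
    by (intro closed_Collect_le continuous_intros)
  ultimately show ?thesis by simp
qed

text \<open>
  The only points where closedness could fail lie over the apex \<open>0\<close> of the sector, and these are
  kept away by the last assumption. Over the rest of the sector a point of \<open>X\<close> outside the lifted
  sector is separated from the lifted point with the same image by the Hausdorff property.
\<close>

lemma exp_lift_sector_closed:
  fixes X :: "'a::topological_space set" and G :: "'a \<Rightarrow> complex"
  assumes haus: "Hausdorff_space (top_of_set X)" and contG: "continuous_on X G"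
    and \<epsilon>: "0 \<le> \<epsilon>" "\<epsilon> < \<delta>" "\<delta> \<le> pi"
    and l: "continuous_on {w. \<bar>Im w\<bar> < \<delta>} l" "l ` {w. \<bar>Im w\<bar> < \<delta>} \<subseteq> X"
      "\<And>w. \<bar>Im w\<bar> < \<delta> \<Longrightarrow> G (l w) = exp w"
    and apex: "\<And>x. x \<in> X \<Longrightarrow> G x = 0 \<Longrightarrow>
      \<exists>N. openin (top_of_set X) N \<and> x \<in> N \<and> N \<inter> l ` {w. \<bar>Im w\<bar> < \<delta>} = {}"
  shows "closedin (top_of_set X) (l ` {w. \<bar>Im w\<bar> \<le> \<epsilon>})"
proof -
  let ?T = "{w::complex. \<bar>Im w\<bar> < \<delta>}" and ?A = "l ` {w. \<bar>Im w\<bar> \<le> \<epsilon>}"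
  have AT: "?A \<subseteq> l ` ?T" using \<epsilon> by auto
  have openT: "open ?T" by (intro open_Collect_less continuous_intros)
  have "\<exists>N. openin (top_of_set X) N \<and> x \<in> N \<and> N \<subseteq> X - ?A" if x: "x \<in> X - ?A" for x
  proof -
    consider "G x = 0" | "G x \<notin> insert 0 (exp ` {w. \<bar>Im w\<bar> \<le> \<epsilon>})"
      | w where "\<bar>Im w\<bar> \<le> \<epsilon>" "G x = exp w" by auto
    then show ?thesis
    proof cases
      case 1
      then obtain N where N: "openin (top_of_set X) N" "x \<in> N" "N \<inter> l ` ?T = {}"
        using apex[of x] x by auto
      then have "N \<subseteq> X - ?A" using AT openin_imp_subset[OF N(1)] by blast
      then show ?thesis using N(1,2) by blast
    next
      case 2
      let ?S = "insert 0 (exp ` {w. \<bar>Im w\<bar> \<le> \<epsilon>})"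
      have "open (- ?S)" using closed_sector[of \<epsilon>] \<epsilon> by (simp add: open_Compl)
      then have "openin (top_of_set X) (X \<inter> G -` (- ?S))"
        by (rule continuous_openin_preimage_gen[OF contG])
      moreover have "X \<inter> G -` (- ?S) \<subseteq> X - ?A"
      proof
        fix x' assume x': "x' \<in> X \<inter> G -` (- ?S)"
        show "x' \<in> X - ?A"
        proof
          show "x' \<notin> ?A"
          proof
            assume "x' \<in> ?A"
            then obtain w where "\<bar>Im w\<bar> \<le> \<epsilon>" "x' = l w" by blast
            then have "G x' = exp w" using l(3) \<epsilon> by simp
            then show False using x' \<open>\<bar>Im w\<bar> \<le> \<epsilon>\<close> by auto
          qed
        qed (use x' in blast)
      qed
      moreover have "x \<in> X \<inter> G -` (- ?S)" using 2 x by blast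
      ultimately show ?thesis by blast
    next
      case 3
      have wT: "w \<in> ?T" using 3 \<epsilon> by simp
      have "x \<noteq> l w" "l w \<in> X" "x \<in> X" using 3 x l(2) wT by auto
      then obtain O1 O2 where O: "openin (top_of_set X) O1" "openin (top_of_set X) O2"
          "x \<in> O1" "l w \<in> O2" "disjnt O1 O2"
        using haus[unfolded Hausdorff_space_def, rule_format, of x "l w"] by auto
      define W where "W = ?T \<inter> l -` O2"
      have "openin (top_of_set ?T) W"
        unfolding W_def using l(1,2) O(2) by (intro continuous_openin_preimage[of ?T l X]) auto
      then have "open W" using openT openin_open_trans by blast
      then have "open (exp ` W)"
        using inj_on_exp_strip[OF \<epsilon>(3)] unfolding W_def
        by (intro invariance_of_domain) (auto intro: continuous_intros inj_on_subset)
      then have "openin (top_of_set X) (X \<inter> G -` (exp ` W))"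
        by (rule continuous_openin_preimage_gen[OF contG])
      then have "openin (top_of_set X) (O1 \<inter> (X \<inter> G -` (exp ` W)))" using O(1) by (rule openin_Int[rotated])
      moreover have "x \<in> O1 \<inter> (X \<inter> G -` (exp ` W))"
        using O(3,4) x 3 wT unfolding W_def by auto
      moreover have "O1 \<inter> (X \<inter> G -` (exp ` W)) \<subseteq> X - ?A"
      proof
        fix x' assume x': "x' \<in> O1 \<inter> (X \<inter> G -` (exp ` W))"
        have "x' \<notin> ?A"
        proof
          assume "x' \<in> ?A"
          then obtain v where v: "\<bar>Im v\<bar> \<le> \<epsilon>" "x' = l v" by blast
          then have vT: "v \<in> ?T" using \<epsilon> by simp
          obtain u where u: "u \<in> ?T" "l u \<in> O2" "G x' = exp u" using x' unfolding W_def by blast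
          have "exp u = exp v" using u(3) v(2) l(3) vT by simp
          then have "u = v" using inj_on_exp_strip[OF \<epsilon>(3)] u(1) vT by (auto dest: inj_onD)
          then show False using u(2) v(2) x' O(5) unfolding disjnt_def by blast
        qed
        then show "x' \<in> X - ?A" using x' by blast
      qed
      ultimately show ?thesis by blast
    qed
  qed
  then have "openin (top_of_set X) (X - ?A)" by (subst openin_subopen) blast
  moreover have "?A \<subseteq> X" using AT l(2) by blast
  ultimately show ?thesis by (simp add: closedin_def)
qed

text \<open>
  Informally, this is the cohomology class dual to the properly embedded ray \<open>l ` \<real>\<close>. The lifted
  sector is wrapped once around the circle by the argument of \<open>G\<close>, and its two edges go to \<open>1\<close>, the
  value on the complement. The two closed pieces on which continuity is checked are the closed
  lifted sector and the complement of the open one.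
\<close>

lemma circle_map_of_closed_sector:
  fixes X :: "'a::topological_space set" and G :: "'a \<Rightarrow> complex"
  assumes haus: "Hausdorff_space (top_of_set X)" and lh: "local_homeomorphism X G"
    and \<epsilon>: "0 < \<epsilon>" "\<epsilon> < \<delta>" "\<delta> \<le> pi"
    and l: "continuous_on {w. \<bar>Im w\<bar> < \<delta>} l" "l ` {w. \<bar>Im w\<bar> < \<delta>} \<subseteq> X"
      "\<And>w. \<bar>Im w\<bar> < \<delta> \<Longrightarrow> G (l w) = exp w"
    and apex: "\<And>x. x \<in> X \<Longrightarrow> G x = 0 \<Longrightarrow>
      \<exists>N. openin (top_of_set X) N \<and> x \<in> N \<and> N \<inter> l ` {w. \<bar>Im w\<bar> < \<delta>} = {}"
  obtains \<theta> where "continuous_on X \<theta>" "\<theta> ` X \<subseteq> sphere (0::complex) 1"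
    "\<And>w. \<bar>Im w\<bar> \<le> \<epsilon> \<Longrightarrow> \<theta> (l w) = exp (\<i> * of_real (pi * (1 + Im w / \<epsilon>)))"
    "\<And>x. x \<in> X - l ` {w. \<bar>Im w\<bar> \<le> \<epsilon>} \<Longrightarrow> \<theta> x = 1"
proof -
  let ?A = "l ` {w. \<bar>Im w\<bar> \<le> \<epsilon>}" and ?O = "l ` {w. \<bar>Im w\<bar> < \<epsilon>}" and ?T = "{w::complex. \<bar>Im w\<bar> < \<delta>}"
  define \<phi> where "\<phi> x = exp (\<i> * of_real (pi * (1 + Im (Ln (G x)) / \<epsilon>)))" for x
  define \<theta> where "\<theta> x = (if x \<in> ?A then \<phi> x else 1)" for x
  have contG: "continuous_on X G" using lh by (rule local_homeomorphism_continuous)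
  have AX: "?A \<subseteq> X" using l(2) \<epsilon> by auto
  have injT: "inj_on exp ?T" using inj_on_exp_strip \<epsilon> by blast
  have closedA: "closedin (top_of_set X) ?A"
    by (rule exp_lift_sector_closed[OF haus contG less_imp_le[OF \<epsilon>(1)] \<epsilon>(2,3) l apex])
  have "openin (top_of_set X) ?O"
  proof (rule exp_lift_image_open[OF lh])
    show "open {w::complex. \<bar>Im w\<bar> < \<epsilon>}" by (intro open_Collect_less continuous_intros)
    show "inj_on exp {w::complex. \<bar>Im w\<bar> < \<epsilon>}" using \<epsilon> by (intro inj_on_exp_strip) simp
    show "continuous_on {w. \<bar>Im w\<bar> < \<epsilon>} l" using l(1) \<epsilon> by (rule_tac continuous_on_subset) auto
  qed (use l(2,3) \<epsilon> in auto)
  then have closedB: "closedin (top_of_set X) (X - ?O)"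
    by (metis closedin_diff closedin_topspace topspace_euclidean_subtopology)
  have LnG: "Ln (G (l w)) = w" if "\<bar>Im w\<bar> < \<delta>" for w
    using that \<epsilon>(3) l(3)[OF that] by (simp add: Ln_exp)
  have \<phi>: "\<phi> (l w) = exp (\<i> * of_real (pi * (1 + Im w / \<epsilon>)))" if "\<bar>Im w\<bar> \<le> \<epsilon>" for w
    using that \<epsilon>(2) LnG[of w] by (simp add: \<phi>_def)
  have "continuous_on ?A \<phi>"
  proof -
    have "G x \<notin> \<real>\<^sub>\<le>\<^sub>0" if "x \<in> ?A" for x
    proof -
      obtain w where w: "\<bar>Im w\<bar> \<le> \<epsilon>" "x = l w" using \<open>x \<in> ?A\<close> by blast
      then have "Ln (G x) = w" "G x = exp w" using LnG[of w] l(3)[of w] \<epsilon>(2) by auto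
      then have "\<bar>Im (Ln (G x))\<bar> < pi" "G x \<noteq> 0" using w \<epsilon> by auto
      then show ?thesis using Im_Ln_eq_pi[of "G x"] by (auto simp: complex_nonpos_Reals_iff complex_eq_iff)
    qed
    then show ?thesis
      unfolding \<phi>_def using continuous_on_subset[OF contG AX] \<epsilon>(1) by (intro continuous_intros) auto
  qed
  then have contA: "continuous_on ?A \<theta>"
    by (rule continuous_on_eq) (simp add: \<theta>_def)
  have \<theta>B: "\<theta> x = 1" if "x \<in> X - ?O" for x
  proof (cases "x \<in> ?A")
    case True
    then obtain w where w: "\<bar>Im w\<bar> \<le> \<epsilon>" "x = l w" by blast
    then have "\<bar>Im w\<bar> = \<epsilon>" using that by fastforce
    then have "1 + Im w / \<epsilon> = 2 \<or> 1 + Im w / \<epsilon> = 0" using \<epsilon>(1) by (auto simp: abs_if split: if_splits)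
    then have "\<phi> x = exp (\<i> * of_real (pi * 2)) \<or> \<phi> x = exp (\<i> * of_real (pi * 0))"
      using \<phi>[OF w(1)] w(2) by metis
    moreover have "exp (\<i> * of_real (pi * 2)) = 1" using exp_two_pi_i by (simp add: mult_ac)
    ultimately show ?thesis using True by (auto simp: \<theta>_def)
  qed (simp add: \<theta>_def)
  then have contB: "continuous_on (X - ?O) \<theta>"
    using continuous_on_cong[of "X - ?O" "X - ?O" \<theta> "\<lambda>_. 1"] by simp
  have X: "X = ?A \<union> (X - ?O)" using AX by auto
  have "continuous_on (?A \<union> (X - ?O)) \<theta>"
    using continuous_on_cases_local[of ?A "X - ?O" \<theta> \<theta> "\<lambda>_. True"]
      closedA closedB contA contB X by simp
  then have "continuous_on X \<theta>" using X by simp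
  moreover have "\<theta> ` X \<subseteq> sphere 0 1" by (auto simp: \<theta>_def \<phi>_def)
  moreover have "\<theta> (l w) = exp (\<i> * of_real (pi * (1 + Im w / \<epsilon>)))" if "\<bar>Im w\<bar> \<le> \<epsilon>" for w
    using \<phi>[OF that] that by (auto simp: \<theta>_def)
  moreover have "\<theta> x = 1" if "x \<in> X - ?A" for x
    using that by (simp add: \<theta>_def)
  ultimately show ?thesis by (rule that)
qed

text \<open>
  Here \<open>l\<close> is a lift of \<open>exp\<close> to a sheet over a punctured disc around \<open>0\<close> together with a sector
  that leads out to infinity, and \<open>apex\<close> says that no point of \<open>X\<close> over \<open>0\<close> closes up this sheet.
  The contradiction comes from a loop around the puncture that meets the lifted sector once.
\<close>

lemma unfilled_puncture_contradiction:
  fixes X :: "'a::topological_space set" and G :: "'a \<Rightarrow> complex"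
  assumes haus: "Hausdorff_space (top_of_set X)" and lh: "local_homeomorphism X G"
    and triv: "trivial_group (homology_group 1 (top_of_set X))"
    and cov: "covering_space (X - G -` D) G (UNIV - D)"
    and fin: "\<And>v. v \<notin> D \<Longrightarrow> finite {x\<in>X. G x = v}"
    and \<delta>: "0 < \<delta>" "\<delta> \<le> pi"
    and l: "continuous_on {w. Re w < \<rho> \<or> \<bar>Im w\<bar> < \<delta>} l" "l ` {w. Re w < \<rho> \<or> \<bar>Im w\<bar> < \<delta>} \<subseteq> X - G -` D"
      "\<And>w. Re w < \<rho> \<or> \<bar>Im w\<bar> < \<delta> \<Longrightarrow> G (l w) = exp w"
    and apex: "\<And>x. x \<in> X \<Longrightarrow> G x = 0 \<Longrightarrow>
      \<exists>N. openin (top_of_set X) N \<and> x \<in> N \<and> N \<inter> l ` {w. Re w < \<rho> \<or> \<bar>Im w\<bar> < \<delta>} = {}"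
  shows False
proof -
  let ?\<Omega> = "{w. Re w < \<rho> \<or> \<bar>Im w\<bar> < \<delta>}" and ?H = "{w. Re w < \<rho>}"
  define per where "per k = 2 * of_real pi * \<i> * of_nat k" for k :: nat
  have per: "Re (per k) = 0" "Im (per k) = 2 * pi * k" "exp (w + per k) = exp w" for k w
    using exp_integer_2pi[of "of_nat k"] by (auto simp: per_def exp_add mult_ac)
  have lH: "continuous_on ?H l" "l ` ?H \<subseteq> X - G -` D"
    using l(1,2) by (auto intro: continuous_on_subset)
  \<comment> \<open>By uniqueness of lifts, a coincidence at one point of the half-plane is a period.\<close>
  define Per where "Per k \<longleftrightarrow> (\<forall>w\<in>?H. l (w + per k) = l w)" for k
  have PerI: "Per k" if "w \<in> ?H" "l (w + per k) = l w" for w k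
    unfolding Per_def
  proof
    fix v assume v: "v \<in> ?H"
    show "l (v + per k) = l v"
    proof (rule covering_lifts_agree[OF cov, of ?H "\<lambda>w. l (w + per k)" l w])
      show "continuous_on ?H (\<lambda>w. l (w + per k))"
        by (rule continuous_on_compose2[OF lH(1)]) (auto intro!: continuous_intros simp: per)
      show "connected ?H" by (rule convex_connected[OF convex_halfspace_Re_lt])
      show "(\<lambda>w. l (w + per k)) ` ?H \<subseteq> X - G -` D" using lH(2) per(1) by (auto simp: image_subset_iff)
      show "G (l (u + per k)) = G (l u)" if "u \<in> ?H" for u
        using that l(3) by (simp add: per)
    qed (use v that lH in auto)
  qed
  define a where "a = complex_of_real (\<rho> - 1)"
  have a: "Re a < \<rho>" by (simp add: a_def)
  have "exp a \<notin> D" using l(2,3) a by fastforce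
  then have "finite {x\<in>X. G x = exp a}" by (rule fin)
  moreover have "range (\<lambda>k. l (a + per k)) \<subseteq> {x\<in>X. G x = exp a}"
    using lH(2) l(3) a per by (auto simp: image_subset_iff)
  ultimately have "finite (range (\<lambda>k. l (a + per k)))" by (rule rev_finite_subset)
  then have "\<not> inj (\<lambda>k. l (a + per k))" using finite_imageD infinite_UNIV_nat by blast
  then obtain i j where "i \<noteq> j" "l (a + per i) = l (a + per j)" unfolding inj_def by blast
  then obtain i j where ij: "i < j" "l (a + per i) = l (a + per j)" by (metis linorder_neqE_nat)
  have "Per (j - i)"
  proof (rule PerI[of "a + per i"])
    have "a + per i + per (j - i) = a + per j"
      using ij(1) by (simp add: per_def algebra_simps of_nat_diff)
    then show "l (a + per i + per (j - i)) = l (a + per i)" using ij(2) by metis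
  qed (simp add: a per)
  define m where "m = (LEAST k. 0 < k \<and> Per k)"
  have m: "0 < m" "Per m"
    using LeastI[of "\<lambda>k. 0 < k \<and> Per k" "j - i"] ij(1) \<open>Per (j - i)\<close> by (auto simp: m_def)
  have minimal: "m \<le> k" if "0 < k" "Per k" for k
    unfolding m_def using that by (intro Least_le) simp
  define \<epsilon> where "\<epsilon> = \<delta> / 2"
  have \<epsilon>: "0 < \<epsilon>" "\<epsilon> < \<delta>" using \<delta> by (auto simp: \<epsilon>_def)
  have lT: "continuous_on {w. \<bar>Im w\<bar> < \<delta>} l" "l ` {w. \<bar>Im w\<bar> < \<delta>} \<subseteq> X"
      "\<And>w. \<bar>Im w\<bar> < \<delta> \<Longrightarrow> G (l w) = exp w"
    using l by (auto intro: continuous_on_subset)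
  have apexT: "\<exists>N. openin (top_of_set X) N \<and> x \<in> N \<and> N \<inter> l ` {w. \<bar>Im w\<bar> < \<delta>} = {}"
    if "x \<in> X" "G x = 0" for x
  proof -
    obtain N where N: "openin (top_of_set X) N" "x \<in> N" "N \<inter> l ` ?\<Omega> = {}"
      using apex[OF \<open>x \<in> X\<close> \<open>G x = 0\<close>] by auto
    have "l ` {w. \<bar>Im w\<bar> < \<delta>} \<subseteq> l ` ?\<Omega>" by auto
    then have "N \<inter> l ` {w. \<bar>Im w\<bar> < \<delta>} = {}" using N(3) by blast
    then show ?thesis using N(1,2) by blast
  qed
  obtain \<theta> where \<theta>: "continuous_on X \<theta>" "\<theta> ` X \<subseteq> sphere (0::complex) 1"
    "\<And>w. \<bar>Im w\<bar> \<le> \<epsilon> \<Longrightarrow> \<theta> (l w) = exp (\<i> * of_real (pi * (1 + Im w / \<epsilon>)))"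
    "\<And>x. x \<in> X - l ` {w. \<bar>Im w\<bar> \<le> \<epsilon>} \<Longrightarrow> \<theta> x = 1"
    using circle_map_of_closed_sector[OF haus lh \<epsilon> \<delta>(2) lT apexT] by blast
  \<comment> \<open>One period of the lift along a vertical line, centred at the real axis so that the loop starts and
    ends as far as possible from the strip.\<close>
  define y where "y t = 2 * pi * m * (t - 1/2)" for t :: real
  define \<gamma> where "\<gamma> t = l (Complex (\<rho> - 1) (y t))" for t
  define h where "h t = pi * (1 + max (-1) (min 1 (y t / \<epsilon>)))" for t
  have m1: "1 \<le> real m" using m(1) by simp
  have y_bound: "\<bar>y t\<bar> \<le> pi * m" if "t \<in> {0..1}" for t
  proof -
    have "y t = pi * m * (2 * t - 1)" by (simp add: y_def algebra_simps)
    then have "\<bar>y t\<bar> = pi * m * \<bar>2 * t - 1\<bar>" by (simp add: abs_mult)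
    also have "\<dots> \<le> pi * m * 1" using that by (intro mult_left_mono) auto
    finally show ?thesis by simp
  qed
  have \<epsilon>_pi: "\<epsilon> < pi" using \<epsilon> \<delta> by simp
  have pi_m: "pi \<le> pi * real m" using m1 by simp
  have "path \<gamma>"
  proof -
    have "continuous_on {0..1} (\<lambda>t. Complex (\<rho> - 1) (y t))"
      unfolding y_def Complex_eq by (intro continuous_intros)
    then show ?thesis unfolding path_def \<gamma>_def
      by (rule continuous_on_compose2[OF lH(1)]) auto
  qed
  moreover have "path_image \<gamma> \<subseteq> X"
    using lH(2) unfolding path_image_def \<gamma>_def by (auto simp: image_subset_iff)
  moreover have "pathfinish \<gamma> = pathstart \<gamma>"
  proof -
    have "Complex (\<rho> - 1) (y 1) = Complex (\<rho> - 1) (y 0) + per m"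
      by (simp add: complex_eq_iff per y_def algebra_simps)
    then show ?thesis
      using m(2) unfolding Per_def pathfinish_def pathstart_def \<gamma>_def by simp
  qed
  ultimately have not_hom: "\<not> homotopic_loops (sphere 0 1) (\<theta> \<circ> \<gamma>) (\<lambda>t. exp (2 * of_real pi * \<i> * of_real t))"
    using loop_not_mapped_to_circle_generator[OF triv] \<theta>(1,2) by blast
  have "homotopic_loops (sphere 0 1) (\<theta> \<circ> \<gamma>) (\<lambda>t. exp (2 * of_real pi * \<i> * of_real t))"
  proof (rule homotopic_circle_loop_of_angle[of h])
    show "continuous_on {0..1} h" unfolding h_def y_def using \<epsilon>(1) by (intro continuous_intros) auto
    have \<epsilon>_m: "\<epsilon> \<le> pi * real m" using \<epsilon>_pi pi_m by linarith
    have y01: "y 0 = - (pi * m)" "y 1 = pi * m" by (simp_all add: y_def)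
    have "y 0 / \<epsilon> \<le> -1" unfolding y01 using \<epsilon>_m \<epsilon>(1) by (simp add: divide_simps)
    then show "h 0 = 0" by (simp add: h_def)
    have "y 1 / \<epsilon> \<ge> 1" unfolding y01 using \<epsilon>_m \<epsilon>(1) by (simp add: divide_simps)
    then show "h 1 = 2 * pi" by (simp add: h_def)
    fix t :: real assume t: "t \<in> {0..1}"
    let ?w = "Complex (\<rho> - 1) (y t)"
    show "(\<theta> \<circ> \<gamma>) t = exp (\<i> * of_real (h t))"
    proof (cases "\<bar>y t\<bar> \<le> \<epsilon>")
      case True
      then have "-1 \<le> y t / \<epsilon>" "y t / \<epsilon> \<le> 1" using \<epsilon>(1) by (auto simp: field_simps abs_le_iff)
      then have "h t = pi * (1 + Im ?w / \<epsilon>)" by (simp add: h_def)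
      then show ?thesis using \<theta>(3)[of ?w] True by (simp add: \<gamma>_def)
    next
      case False
      have "\<gamma> t \<notin> l ` {w. \<bar>Im w\<bar> \<le> \<epsilon>}"
      proof
        assume "\<gamma> t \<in> l ` {w. \<bar>Im w\<bar> \<le> \<epsilon>}"
        then obtain v where v: "\<bar>Im v\<bar> \<le> \<epsilon>" "l ?w = l v" unfolding \<gamma>_def by blast
        have "exp ?w = exp v" using v l(3)[of ?w] l(3)[of v] \<epsilon>(2) by simp
        then obtain k :: int where k: "v = ?w + of_int (2 * k) * pi * \<i>"
          using exp_eq[of v ?w] by auto
        have vH: "v \<in> ?H" using k by simp
        have Imv: "Im v = y t + 2 * pi * k" using k by simp
        have "k \<noteq> 0" using Imv v(1) False by auto
        have "2 * pi * \<bar>real_of_int k\<bar> = \<bar>Im v - y t\<bar>" using Imv by (simp add: abs_mult)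
        also have "\<dots> \<le> \<bar>Im v\<bar> + \<bar>y t\<bar>" by (rule abs_triangle_ineq4)
        \<comment> \<open>The loop stays within height \<open>\<pi>m\<close>, and the strip within \<open>\<pi>\<close>, so a second crossing
          would give a period smaller than \<open>m\<close>.\<close>
        also have "\<dots> < pi + pi * m" using v(1) \<epsilon>_pi y_bound[OF t] by linarith
        also have "\<dots> \<le> 2 * pi * m" using pi_m by linarith
        finally have k_less: "nat \<bar>k\<bar> < m" by (simp add: nat_less_iff)
        have "Per (nat \<bar>k\<bar>)"
        proof (cases "0 < k")
          case True
          then have "v = ?w + per (nat \<bar>k\<bar>)" using k by (simp add: per_def mult_ac)
          then show ?thesis using PerI[of ?w] v(2) by simp
        next
          case False
          then have "?w = v + per (nat \<bar>k\<bar>)" using k by (simp add: per_def mult_ac)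
          then show ?thesis using PerI[OF vH] v(2) by simp
        qed
        then show False using minimal[of "nat \<bar>k\<bar>"] k_less \<open>k \<noteq> 0\<close> by simp
      qed
      moreover have "\<gamma> t \<in> X" using lH(2) by (auto simp: \<gamma>_def image_subset_iff)
      ultimately have "\<theta> (\<gamma> t) = 1" using \<theta>(4) by blast
      moreover have "h t = 0 \<or> h t = 2 * pi"
      proof (cases "0 \<le> y t")
        case True
        then have "y t / \<epsilon> \<ge> 1" using False \<epsilon>(1) by (simp add: field_simps)
        then show ?thesis by (simp add: h_def)
      next
        case neg: False
        then have "y t / \<epsilon> \<le> -1" using False \<epsilon>(1) by (simp add: field_simps)
        then show ?thesis by (simp add: h_def)
      qed
      then have "exp (\<i> * of_real (h t)) = 1"
        using exp_two_pi_i by (auto simp: mult_ac)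
      ultimately show ?thesis by simp
    qed
  qed
  then show False using not_hom by blast
qed

text \<open>
  The condition on \<open>D\<close> says that the open positive real axis misses \<open>D\<close>; since \<open>D\<close> is finite, so does
  a sector of some positive opening \<open>\<delta>\<close> around it.
\<close>

lemma puncture_fibre_card:
  fixes X :: "'a::topological_space set" and G :: "'a \<Rightarrow> complex"
  assumes haus: "Hausdorff_space (top_of_set X)" and lh: "local_homeomorphism X G"
    and triv: "trivial_group (homology_group 1 (top_of_set X))"
    and D: "finite D" "0 \<in> D" "\<And>z. z \<in> D \<Longrightarrow> Im z = 0 \<Longrightarrow> Re z \<le> 0"
    and cov: "covering_space (X - G -` D) G (UNIV - D)"
    and n: "\<And>v. v \<notin> D \<Longrightarrow> finite {x\<in>X. G x = v} \<and> card {x\<in>X. G x = v} = n"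
  shows "card {x\<in>X. G x = 0} = n"
proof (rule ccontr)
  assume neq: "card {x\<in>X. G x = 0} \<noteq> n"
  define P where "P = {x\<in>X. G x = 0}"
  have P: "finite P" "card P < n"
    using fibre_card_le_nearby[OF haus lh D(1) n, of 0] neq unfolding P_def by auto
  \<comment> \<open>The radius \<open>r0\<close> and the angle \<open>\<delta>\<close> keep the disc and the sector away from the rest of \<open>D\<close>.\<close>
  define r0 where "r0 = Min (insert 1 (cmod ` (D - {0})))"
  define \<delta> where "\<delta> = Min (insert pi ((\<lambda>z. \<bar>Im (Ln z)\<bar>) ` (D - {0})))"
  have "Im (Ln z) \<noteq> 0" if "z \<in> D - {0}" for z
    using that D(3)[of z] Im_Ln_eq_0[of z] by (auto simp: complex_eq_iff)
  then have \<delta>: "0 < \<delta>" "\<delta> \<le> pi" "\<And>z. z \<in> D - {0} \<Longrightarrow> \<delta> \<le> \<bar>Im (Ln z)\<bar>"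
    unfolding \<delta>_def using D(1) by (auto simp: Min_gr_iff)
  have r0: "0 < r0" "\<And>z. z \<in> D - {0} \<Longrightarrow> r0 \<le> cmod z"
    unfolding r0_def using D(1) by (auto simp: Min_gr_iff)
  have PX: "P \<subseteq> X" and P0: "\<And>x. x \<in> P \<Longrightarrow> G x = 0" by (auto simp: P_def)
  obtain r s where rs: "0 < r" "r \<le> r0"
    "\<And>x. x \<in> P \<Longrightarrow> continuous_on (ball 0 r) (s x)"
    "\<And>x. x \<in> P \<Longrightarrow> s x 0 = x"
    "\<And>x v. x \<in> P \<Longrightarrow> v \<in> ball 0 r \<Longrightarrow> G (s x v) = v"
    "\<And>x. x \<in> P \<Longrightarrow> openin (top_of_set X) (s x ` ball 0 r)"
    "\<And>x x' v. x \<in> P \<Longrightarrow> x' \<in> P \<Longrightarrow> v \<in> ball 0 r \<Longrightarrow> s x v = s x' v \<Longrightarrow> x = x'"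
    using disjoint_local_sections[OF haus lh P(1) PX P0 r0(1)] by blast
  define \<rho> where "\<rho> = ln r"
  let ?\<Omega> = "{w. Re w < \<rho> \<or> \<bar>Im w\<bar> < \<delta>}" and ?H = "{w. Re w < \<rho>}"
  define b where "b = complex_of_real (ln (r / 2))"
  have b: "Re b < \<rho>" "Im b = 0" using rs(1) by (auto simp: b_def \<rho>_def)
  have exp_ball: "exp w \<in> ball 0 r \<longleftrightarrow> Re w < \<rho>" for w
  proof -
    have "exp w \<in> ball 0 r \<longleftrightarrow> exp (Re w) < exp (ln r)" using rs(1) by simp
    then show ?thesis unfolding \<rho>_def exp_less_cancel_iff .
  qed
  have avoid: "exp w \<notin> D" if w: "w \<in> ?\<Omega>" for w
  proof
    assume "exp w \<in> D"
    then have ew: "exp w \<in> D - {0}" by simp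
    consider "Re w < \<rho>" | "\<bar>Im w\<bar> < \<delta>" using w by blast
    then show False
    proof cases
      case 1
      then have "cmod (exp w) < r" using exp_ball[of w] by simp
      then show False using r0(2)[OF ew] rs(2) by simp
    next
      case 2
      then have "Ln (exp w) = w" using \<delta>(2) by (simp add: Ln_exp)
      then show False using \<delta>(3)[OF ew] 2 by simp
    qed
  qed
  have "exp b \<notin> D" using avoid b(1) by simp
  moreover have "card ((\<lambda>x. s x (exp b)) ` P) < n" using P card_image_le le_less_trans by blast
  ultimately have "\<not> {x\<in>X. G x = exp b} \<subseteq> (\<lambda>x. s x (exp b)) ` P"
    using n[of "exp b"] P(1) card_mono[of "(\<lambda>x. s x (exp b)) ` P" "{x\<in>X. G x = exp b}"] by auto
  \<comment> \<open>A point over the punctured disc on none of the sheets that pass through the points over \<open>0\<close>.\<close>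
  then obtain y where y: "y \<in> X" "G y = exp b" "y \<notin> (\<lambda>x. s x (exp b)) ` P" by blast
  have open\<Omega>: "open ?\<Omega>"
    by (intro open_Collect_disj open_Collect_less continuous_intros)
  have star: "closed_segment b w \<subseteq> ?\<Omega>" if w: "w \<in> ?\<Omega>" for w
  proof -
    consider "Re w < \<rho>" | "\<bar>Im w\<bar> < \<delta>" using w by blast
    then show ?thesis
    proof cases
      case 1
      then have "closed_segment b w \<subseteq> ?H"
        using b by (intro closed_segment_subset convex_halfspace_Re_lt) auto
      then show ?thesis by blast
    next
      case 2
      have "convex ({w. Im w < \<delta>} \<inter> {w. Im w > - \<delta>})"
        by (intro convex_Int convex_halfspace_Im_lt convex_halfspace_Im_gt)
      then have "closed_segment b w \<subseteq> {w. Im w < \<delta>} \<inter> {w. Im w > - \<delta>}"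
        using b(2) \<delta>(1) 2 by (intro closed_segment_subset) auto
      then show ?thesis by (auto simp: abs_less_iff)
    qed
  qed
  obtain l where l: "continuous_on ?\<Omega> l" "l ` ?\<Omega> \<subseteq> X - G -` D" "l b = y" "\<And>w. w \<in> ?\<Omega> \<Longrightarrow> G (l w) = exp w"
  proof (rule covering_lift_starlike[OF cov _ open\<Omega>, of y exp b])
    show "y \<in> X - G -` D" using y \<open>exp b \<notin> D\<close> by simp
    show "continuous_on ?\<Omega> exp" by (intro continuous_intros)
    show "exp ` ?\<Omega> \<subseteq> UNIV - D" using avoid by blast
    show "exp b = G y" using y by simp
    show "b \<in> ?\<Omega>" using b by simp
  qed (use star in auto)
  have "\<exists>N. openin (top_of_set X) N \<and> x \<in> N \<and> N \<inter> l ` ?\<Omega> = {}" if "x \<in> X" "G x = 0" for x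
  proof (intro exI[of _ "s x ` ball 0 r"] conjI)
    have x: "x \<in> P" using that by (simp add: P_def)
    show opN: "openin (top_of_set X) (s x ` ball 0 r)" by (rule rs(6)[OF x])
    show "x \<in> s x ` ball 0 r" using rs(4)[OF x] rs(1) by (metis centre_in_ball imageI)
    show "s x ` ball 0 r \<inter> l ` ?\<Omega> = {}"
    proof (rule ccontr)
      assume "s x ` ball 0 r \<inter> l ` ?\<Omega> \<noteq> {}"
      then obtain u w where uw: "u \<in> ball 0 r" "w \<in> ?\<Omega>" "s x u = l w" by blast
      then have "u = exp w" using rs(5)[OF x uw(1)] l(4)[OF uw(2)] by simp
      then have w: "w \<in> ?H" "s x (exp w) = l w" using exp_ball[of w] uw by auto
      \<comment> \<open>If the lift met the sheet through \<open>x\<close>, it would follow it over the whole punctured disc.\<close>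
      have "s x (exp b) = l b"
      proof (rule covering_lifts_agree[OF cov, of ?H "\<lambda>w. s x (exp w)" l w])
        show "continuous_on ?H (\<lambda>w. s x (exp w))"
          by (rule continuous_on_compose2[OF rs(3)[OF x]]) (use exp_ball in \<open>auto intro!: continuous_intros\<close>)
        have "s x (exp v) \<in> X - G -` D" if "v \<in> ?H" for v
        proof -
          have "exp v \<in> ball 0 r" "exp v \<notin> D" using exp_ball[of v] avoid[of v] that by auto
          then show ?thesis using rs(5)[OF x, of "exp v"] openin_imp_subset[OF opN] by auto
        qed
        then show "(\<lambda>w. s x (exp w)) ` ?H \<subseteq> X - G -` D" by blast
        show "G (s x (exp v)) = G (l v)" if "v \<in> ?H" for v
          using that rs(5)[OF x, of "exp v"] exp_ball[of v] l(4)[of v] by simp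
        show "continuous_on ?H l" by (rule continuous_on_subset[OF l(1)]) blast
        show "connected ?H" by (rule convex_connected[OF convex_halfspace_Re_lt])
      qed (use w b l(2) in auto)
      then show False using y(3) x l(3) by auto
    qed
  qed
  then show False
    using unfilled_puncture_contradiction[OF haus lh triv cov _ \<delta>(1,2) l(1,2)] n l(4) by auto
qed

section \<open>Maps to the plane\<close>

lemma local_homeomorphism_compose_homeomorphism:
  assumes lh: "local_homeomorphism X F" and h: "homeomorphism UNIV UNIV h k"
  shows "local_homeomorphism X (h \<circ> F)"
  unfolding local_homeomorphism_def
proof
  fix x assume "x \<in> X"
  then obtain U V g where U: "x \<in> U" "openin (top_of_set X) U" "open V" "homeomorphism U V F g"
    using lh unfolding local_homeomorphism_def by meson
  have "openin (top_of_set UNIV) (h ` V)"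
    using U(3) by (intro homeomorphism_imp_open_map[OF h]) simp
  then have "open (h ` V)" by simp
  moreover have "homeomorphism V (h ` V) h k"
    using h by (rule homeomorphism_of_subsets) auto
  then have "homeomorphism U (h ` V) (h \<circ> F) (g \<circ> k)" using U(4) homeomorphism_compose by blast
  ultimately show "\<exists>U V g. x \<in> U \<and> openin (top_of_set X) U \<and> open V \<and> homeomorphism U V (h \<circ> F) g"
    using U(1,2) by blast
qed

lemma covering_space_compose_homeomorphism:
  assumes cov: "covering_space C p S" and h: "homeomorphism S T h k"
  shows "covering_space C (h \<circ> p) T"
proof
  have pC: "p ` C = S" using cov by (rule covering_space_imp_surjective)
  show "continuous_on C (h \<circ> p)"
    using covering_space_imp_continuous[OF cov] homeomorphism_cont1[OF h] pC
    by (intro continuous_on_compose) auto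
  show "(h \<circ> p) ` C = T" using pC homeomorphism_image1[OF h] unfolding image_comp[symmetric] by simp
  fix y assume y: "y \<in> T"
  then have "k y \<in> S" using homeomorphism_image2[OF h] by blast
  then obtain N v where N: "k y \<in> N" "openin (top_of_set S) N" "\<Union>v = C \<inter> p -` N"
    "\<And>u. u \<in> v \<Longrightarrow> openin (top_of_set C) u" "pairwise disjnt v"
    "\<And>u. u \<in> v \<Longrightarrow> \<exists>q. homeomorphism u N p q"
    using evenly_covered[OF cov] by metis
  have NS: "N \<subseteq> S" using N(2) openin_imp_subset by blast
  have hN: "homeomorphism N (h ` N) h k"
    using h NS homeomorphism_image1[OF h] by (intro homeomorphism_of_subsets[OF h]) auto
  have "C \<inter> (h \<circ> p) -` (h ` N) = C \<inter> p -` N"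
  proof -
    have "p z \<in> N" if "z \<in> C" "h (p z) = h w" "w \<in> N" for z w
    proof -
      have "p z \<in> S" using pC that(1) by blast
      then have "p z = w" using homeomorphism_apply1[OF h] that NS by (metis subsetD)
      then show ?thesis using that(3) by simp
    qed
    then show ?thesis by auto
  qed
  moreover have "y \<in> h ` N" using N(1) homeomorphism_apply2[OF h y] by (metis imageI)
  moreover have "openin (top_of_set T) (h ` N)" using homeomorphism_imp_open_map[OF h N(2)] .
  moreover have "\<exists>q. homeomorphism u (h ` N) (h \<circ> p) q" if "u \<in> v" for u
    using N(6)[OF that] hN homeomorphism_compose by blast
  ultimately show "\<exists>V. y \<in> V \<and> openin (top_of_set T) V \<and>
      (\<exists>v. \<Union>v = C \<inter> (h \<circ> p) -` V \<and> (\<forall>u\<in>v. openin (top_of_set C) u) \<and>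
           pairwise disjnt v \<and> (\<forall>u\<in>v. \<exists>q. homeomorphism u V (h \<circ> p) q))"
    using N(3,4,5) by (intro exI[of _ "h ` N"] conjI exI[of _ v]) auto
qed

text \<open>
  A direction \<open>u = Complex 1 t\<close> is chosen whose slope \<open>t\<close> differs from that of \<open>z - p\<close> for
  every \<open>z\<close> in \<open>D\<close>; dividing by \<open>u\<close> turns the ray from \<open>p\<close> in this direction into the positive
  real axis.
\<close>

lemma plane_homeomorphism_clear_ray:
  fixes D :: "(real^2) set"
  assumes "finite D"
  obtains h k where "homeomorphism UNIV UNIV h k" "h p = (0::complex)"
    "\<And>z. z \<in> D \<Longrightarrow> Im (h z) = 0 \<Longrightarrow> Re (h z) \<le> 0"
proof -
  define \<iota> where "\<iota> v = Complex (v$1 - p$1) (v$2 - p$2)" for v :: "real^2"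
  obtain t where t: "t \<notin> (\<lambda>z. Im (\<iota> z) / Re (\<iota> z)) ` D"
    using ex_new_if_finite[OF infinite_UNIV_char_0] assms by (metis finite_imageI)
  define u where "u = Complex 1 t"
  define h where "h v = \<iota> v / u" for v
  define k :: "complex \<Rightarrow> real^2"
    where "k z = (\<chi> i. if i = 1 then Re (z * u) + p$1 else Im (z * u) + p$2)" for z
  have "u \<noteq> 0" by (simp add: u_def complex_eq_iff)
  have hk: "h (k z) = z" for z
  proof -
    have "\<iota> (k z) = z * u" by (simp add: complex_eq_iff k_def \<iota>_def)
    then show ?thesis using \<open>u \<noteq> 0\<close> by (simp add: h_def)
  qed
  have kh: "k (h v) = v" for v
  proof -
    have "h v * u = \<iota> v" using \<open>u \<noteq> 0\<close> by (simp add: h_def)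
    then show ?thesis unfolding k_def by (simp add: \<iota>_def vec_eq_iff forall_2)
  qed
  have "homeomorphism UNIV UNIV h k"
  proof (rule homeomorphismI)
    show "continuous_on UNIV h" unfolding h_def \<iota>_def Complex_eq using \<open>u \<noteq> 0\<close>
      by (intro continuous_intros) auto
    have "continuous_on UNIV (\<lambda>z. if i = 1 then Re (z * u) + p$1 else Im (z * u) + p$2)" for i :: 2
      by (cases "i = 1") (auto intro!: continuous_intros)
    then show "continuous_on UNIV k" unfolding k_def by (intro continuous_on_vec_lambda)
  qed (use hk kh in auto)
  moreover have "\<iota> p = 0" by (simp add: \<iota>_def complex_eq_iff)
  then have "h p = 0" by (simp add: h_def)
  moreover have "Re (h z) \<le> 0" if z: "z \<in> D" "Im (h z) = 0" for z
  proof (rule ccontr)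
    assume pos: "\<not> Re (h z) \<le> 0"
    have "\<iota> z = of_real (Re (h z)) * u"
      using z(2) \<open>u \<noteq> 0\<close> by (metis complex_is_Real_iff h_def nonzero_divide_eq_eq of_real_Re)
    then have "Re (\<iota> z) = Re (h z)" "Im (\<iota> z) = Re (h z) * t" by (auto simp: u_def)
    then have "t = Im (\<iota> z) / Re (\<iota> z)" using pos by simp
    then show False using t z(1) by blast
  qed
  ultimately show ?thesis by (rule that)
qed

lemma puncture_fibre_card_plane:
  fixes X :: "'a::topological_space set" and F :: "'a \<Rightarrow> real^2"
  assumes haus: "Hausdorff_space (top_of_set X)" and lh: "local_homeomorphism X F"
    and triv: "trivial_group (homology_group 1 (top_of_set X))"
    and D: "finite D" "p \<in> D"
    and cov: "covering_space (X - F -` D) F (UNIV - D)"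
    and n: "\<And>v. v \<notin> D \<Longrightarrow> finite {x\<in>X. F x = v} \<and> card {x\<in>X. F x = v} = n"
  shows "card {x\<in>X. F x = p} = n"
proof -
  obtain h k where h: "homeomorphism UNIV UNIV h k" "h p = (0::complex)"
    "\<And>z. z \<in> D \<Longrightarrow> Im (h z) = 0 \<Longrightarrow> Re (h z) \<le> 0"
    using plane_homeomorphism_clear_ray[OF D(1)] by blast
  have kh: "k (h v) = v" "h (k z) = z" for v z
    using homeomorphism_apply1[OF h(1)] homeomorphism_apply2[OF h(1)] by auto
  have h_eq: "h v = z \<longleftrightarrow> v = k z" for v z using kh by metis
  have hD: "h v \<in> h ` D \<longleftrightarrow> v \<in> D" for v using kh by (metis imageE imageI)
  have "homeomorphism (UNIV - D) (UNIV - h ` D) h k"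
  proof (rule homeomorphism_of_subsets[OF h(1)])
    show "h ` (UNIV - D) = UNIV - h ` D"
    proof
      show "UNIV - h ` D \<subseteq> h ` (UNIV - D)" using kh by (metis Diff_iff UNIV_I hD image_eqI subsetI)
    qed (use hD in auto)
  qed auto
  then have "covering_space (X - F -` D) (h \<circ> F) (UNIV - h ` D)"
    by (rule covering_space_compose_homeomorphism[OF cov])
  moreover have "(h \<circ> F) -` (h ` D) = F -` D" by (simp add: vimage_def hD)
  ultimately have cov': "covering_space (X - (h \<circ> F) -` (h ` D)) (h \<circ> F) (UNIV - h ` D)" by simp
  have fibre: "{x\<in>X. (h \<circ> F) x = v} = {x\<in>X. F x = k v}" for v by (simp add: h_eq)
  have "card {x\<in>X. (h \<circ> F) x = 0} = n"
  proof (rule puncture_fibre_card[OF haus _ triv _ _ _ cov'])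
    show "local_homeomorphism X (h \<circ> F)"
      by (rule local_homeomorphism_compose_homeomorphism[OF lh h(1)])
    show "finite {x\<in>X. (h \<circ> F) x = v} \<and> card {x\<in>X. (h \<circ> F) x = v} = n" if "v \<notin> h ` D" for v
      unfolding fibre using that hD[of "k v"] kh by (intro n) simp
    show "0 \<in> h ` D" using D(2) h(2) by (metis imageI)
  qed (use D h(3) in auto)
  moreover have "k 0 = p" using h(2) kh by metis
  ultimately show ?thesis unfolding fibre by simp
qed


theorem corollary1p8:
  fixes X :: "'a::topological_space set"
    and \<A> :: "('a, 'e::euclidean_space) chart set"
    and F :: "'a \<Rightarrow> real^2"
    and D :: "(real^2) set"
    and d :: enat
  assumes "smooth_manifold X \<A>"
    and "connected X"
    and "trivial_group (homology_group 1 (top_of_set X))"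
    and "local_diffeomorphism X \<A> UNIV euclidean_atlas F"
    and "finite D"
    and "0 < d"
    and "sheeted_covering d (X - F -` D) F (UNIV - D)"
  shows "d = 1 \<or> d = \<infinity>"
proof (cases d)
  case (enat n)
  have haus: "Hausdorff_space (top_of_set X)"
    using assms(1) by (simp add: smooth_manifold_def)
  have lh: "local_homeomorphism X F"
    unfolding local_homeomorphism_def
  proof
    fix x assume "x \<in> X"
    then obtain U V g where "x \<in> U" "openin (top_of_set X) U" "openin (top_of_set UNIV) V"
        "homeomorphism U V F g"
      using assms(4) unfolding local_diffeomorphism_def by blast
    then show "\<exists>U V g. x \<in> U \<and> openin (top_of_set X) U \<and> open V \<and> homeomorphism U V F g"
      by auto
  qed
  have cov: "covering_space (X - F -` D) F (UNIV - D)"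
    using assms(7) by (simp add: sheeted_covering_def)
  have n: "finite {x\<in>X. F x = v} \<and> card {x\<in>X. F x = v} = n" if "v \<notin> D" for v
  proof -
    have "{x \<in> X - F -` D. F x = v} = {x\<in>X. F x = v}" using that by auto
    moreover have "has_ecard {x \<in> X - F -` D. F x = v} d"
      using assms(7) that unfolding sheeted_covering_def by blast
    ultimately show ?thesis by (simp add: has_ecard_def enat)
  qed
  have all: "finite {x\<in>X. F x = v} \<and> card {x\<in>X. F x = v} = n" for v
    using n[of v] fibre_card_le_nearby[OF haus lh assms(5) n, of v]
      puncture_fibre_card_plane[OF haus lh assms(3,5) _ cov n, of v] by blast
  have "0 < n" using assms(6) enat by (simp add: zero_enat_def)
  then have "covering_space X F UNIV"
    by (rule covering_space_of_constant_fibre_card[OF haus lh all])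
  then have inj: "inj_on F X"
    using assms(2) by (rule connected_cover_of_euclidean_space_inj)
  have "\<forall>x\<in>{x\<in>X. F x = 0}. \<forall>y\<in>{x\<in>X. F x = 0}. x = y"
    using inj by (simp add: inj_on_def)
  then have "card {x\<in>X. F x = 0} \<le> 1"
    using card_le_Suc0_iff_eq[of "{x\<in>X. F x = 0}"] all[of 0] by simp
  then have "n = 1" using all[of 0] \<open>0 < n\<close> by simp
  then show ?thesis using enat by (simp add: one_enat_def)
qed simp

end
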